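(* There exist infinitely many pairwise distinct hereditary classes of graphs $X$ such that $X$ is both a minimal hereditary class of unbounded clique-width and a minimal hereditary class of unbounded linear clique-width.
   Context: Graphs are undirected, finite, nonempty, without loops or multiple edges. A class of graphs (closed under isomorphism) is hereditary if it is closed under taking induced subgraphs. The clique-width $\mathrm{cwd}(G)$ of a graph $G$ is the minimum number of labels needed to construct $G$ (as a labelled graph, labels then forgotten) by an expression using the following operations: creation of a new vertex $v$ with label $i$ (denoted $i(v)$); disjoint union $\oplus$ of two labelled graphs; $\eta_{i,j}$ ($i\neq j$), adding all edges between vertices labelled $i$ and vertices labelled $j$; $\rho_{i\to j}$, renaming label $i$ to label $j$. The linear clique-width $\mathrm{lcwd}(G)$ is the minimum number of labels in such an expression whose associated tree is a caterpillar, i.e. in which every $\oplus$-operation has at least one operand that is a single newly created vertex. A class has unbounded clique-width (respectively, linear clique-width) if there is no constant $c$ with $\mathrm{cwd}(G)\le c$ (respectively, $\mathrm{lcwd}(G)\le c$) for all $G$ in the class. A hereditary class $X$ is a minimal hereditary class of unbounded clique-width (respectively, linear clique-width) if $X$ has unbounded clique-width (respectively, linear clique-width) and every hereditary class properly contained in $X$ has bounded clique-width (respectively, linear clique-width). *)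

theory Defs
  imports Main
begin

section \<open>Graphs and hereditary classes\<close>

type_synonym 'a graph = "'a set \<times> 'a set set"

abbreviation verts :: "'a graph \<Rightarrow> 'a set" where "verts \<equiv> fst"
abbreviation edges :: "'a graph \<Rightarrow> 'a set set" where "edges \<equiv> snd"

definition simple_graph :: "'a graph \<Rightarrow> bool" where
  "simple_graph G \<longleftrightarrow>
     finite (verts G) \<and> verts G \<noteq> {} \<and> (\<forall>e\<in>edges G. e \<subseteq> verts G \<and> card e = 2)"

definition graph_iso :: "'a graph \<Rightarrow> 'b graph \<Rightarrow> bool" where
  "graph_iso G H \<longleftrightarrow>
     (\<exists>f. bij_betw f (verts G) (verts H) \<and>
          (\<forall>u\<in>verts G. \<forall>v\<in>verts G. {u, v} \<in> edges G \<longleftrightarrow> {f u, f v} \<in> edges H))"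

definition induced_subgraph :: "'a graph \<Rightarrow> 'a set \<Rightarrow> 'a graph" where
  "induced_subgraph G S = (S, {e \<in> edges G. e \<subseteq> S})"

text \<open>
  Every finite graph has an isomorphic copy with vertices in \<^typ>\<open>nat\<close>, so for
  \<open>'a = nat\<close> the isomorphism-closed sets of simple graphs are exactly the
  isomorphism-closed classes of finite graphs, and two such classes are equal iff the sets are.
\<close>

definition graph_class :: "'a graph set \<Rightarrow> bool" where
  "graph_class X \<longleftrightarrow>
     (\<forall>G\<in>X. simple_graph G) \<and>
     (\<forall>G\<in>X. \<forall>H. simple_graph H \<and> graph_iso G H \<longrightarrow> H \<in> X)"

definition hereditary :: "'a graph set \<Rightarrow> bool" where
  "hereditary X \<longleftrightarrow>
     graph_class X \<and>
     (\<forall>G\<in>X. \<forall>S. S \<subseteq> verts G \<and> S \<noteq> {} \<longrightarrow> induced_subgraph G S \<in> X)"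

section \<open>Clique-width and linear clique-width\<close>

datatype 'a cw_expr =
    Create nat 'a                          \<comment> \<open>\<open>i(v)\<close>\<close>
  | DisjUnion "'a cw_expr" "'a cw_expr"    \<comment> \<open>\<open>\<oplus>\<close>\<close>
  | Join nat nat "'a cw_expr"              \<comment> \<open>\<open>\<eta>\<close> with indices \<open>i, j\<close>\<close>
  | Relabel nat nat "'a cw_expr"           \<comment> \<open>\<open>\<rho>\<close> with index \<open>i \<rightarrow> j\<close>\<close>

primrec cw_verts :: "'a cw_expr \<Rightarrow> 'a set" where
  "cw_verts (Create i v) = {v}"
| "cw_verts (DisjUnion s t) = cw_verts s \<union> cw_verts t"
| "cw_verts (Join i j t) = cw_verts t"
| "cw_verts (Relabel i j t) = cw_verts t"

text \<open>The label of a vertex; meaningful only on \<^term>\<open>cw_verts t\<close>.\<close>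

primrec cw_label :: "'a cw_expr \<Rightarrow> 'a \<Rightarrow> nat" where
  "cw_label (Create i v) = (\<lambda>_. i)"
| "cw_label (DisjUnion s t) = (\<lambda>x. if x \<in> cw_verts s then cw_label s x else cw_label t x)"
| "cw_label (Join i j t) = cw_label t"
| "cw_label (Relabel i j t) = (\<lambda>x. if cw_label t x = i then j else cw_label t x)"

primrec cw_edges :: "'a cw_expr \<Rightarrow> 'a set set" where
  "cw_edges (Create i v) = {}"
| "cw_edges (DisjUnion s t) = cw_edges s \<union> cw_edges t"
| "cw_edges (Join i j t) = cw_edges t \<union>
     {{u, v} | u v. u \<in> cw_verts t \<and> v \<in> cw_verts t \<and> cw_label t u = i \<and> cw_label t v = j}"
| "cw_edges (Relabel i j t) = cw_edges t"

primrec cw_wf :: "'a cw_expr \<Rightarrow> bool" where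
  "cw_wf (Create i v) \<longleftrightarrow> True"
| "cw_wf (DisjUnion s t) \<longleftrightarrow> cw_wf s \<and> cw_wf t \<and> cw_verts s \<inter> cw_verts t = {}"
| "cw_wf (Join i j t) \<longleftrightarrow> cw_wf t \<and> i \<noteq> j"
| "cw_wf (Relabel i j t) \<longleftrightarrow> cw_wf t"

primrec cw_labels :: "'a cw_expr \<Rightarrow> nat set" where
  "cw_labels (Create i v) = {i}"
| "cw_labels (DisjUnion s t) = cw_labels s \<union> cw_labels t"
| "cw_labels (Join i j t) = {i, j} \<union> cw_labels t"
| "cw_labels (Relabel i j t) = {i, j} \<union> cw_labels t"

definition is_Create :: "'a cw_expr \<Rightarrow> bool" where
  "is_Create t \<longleftrightarrow> (\<exists>i v. t = Create i v)"

primrec cw_linear :: "'a cw_expr \<Rightarrow> bool" where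
  "cw_linear (Create i v) \<longleftrightarrow> True"
| "cw_linear (DisjUnion s t) \<longleftrightarrow> cw_linear s \<and> cw_linear t \<and> (is_Create s \<or> is_Create t)"
| "cw_linear (Join i j t) \<longleftrightarrow> cw_linear t"
| "cw_linear (Relabel i j t) \<longleftrightarrow> cw_linear t"

definition cw_constructs :: "'a cw_expr \<Rightarrow> 'a graph \<Rightarrow> bool" where
  "cw_constructs t G \<longleftrightarrow> cw_wf t \<and> cw_verts t = verts G \<and> cw_edges t = edges G"

definition cwd :: "'a graph \<Rightarrow> nat" where
  "cwd G = (LEAST k. \<exists>t. cw_constructs t G \<and> card (cw_labels t) = k)"

definition lcwd :: "'a graph \<Rightarrow> nat" where
  "lcwd G = (LEAST k. \<exists>t. cw_constructs t G \<and> cw_linear t \<and> card (cw_labels t) = k)"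

text \<open>
  Every simple graph has a linear expression (give each vertex its own label), so both minima
  are attained.
\<close>

lemma ex_linear_joins:
  assumes "finite N" "cw_wf t" "cw_linear t" "inj_on (cw_label t) (cw_verts t)"
    "N \<subseteq> cw_verts t" "v \<in> cw_verts t" "v \<notin> N"
  shows "\<exists>t'. cw_wf t' \<and> cw_linear t' \<and> cw_verts t' = cw_verts t \<and> cw_label t' = cw_label t \<and>
           cw_edges t' = cw_edges t \<union> {{u, v} | u. u \<in> N}"
  using assms
proof (induction N rule: finite_induct)
  case empty
  then show ?case by (intro exI[of _ t]) auto
next
  case (insert u N)
  then obtain t' where t': "cw_wf t'" "cw_linear t'" "cw_verts t' = cw_verts t"
    "cw_label t' = cw_label t" "cw_edges t' = cw_edges t \<union> {{u, v} | u. u \<in> N}"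
    by auto
  have ne: "cw_label t u \<noteq> cw_label t v"
    using insert.prems by (auto dest: inj_onD)
  have "{{a, b} | a b. a \<in> cw_verts t \<and> b \<in> cw_verts t \<and>
          cw_label t a = cw_label t u \<and> cw_label t b = cw_label t v} = {{u, v}}" (is "?A = _")
  proof
    show "?A \<subseteq> {{u, v}}"
    proof
      fix e assume "e \<in> ?A"
      then obtain a b where ab: "e = {a, b}" "a \<in> cw_verts t" "b \<in> cw_verts t"
        "cw_label t a = cw_label t u" "cw_label t b = cw_label t v" by auto
      then have "a = u" "b = v"
        using insert.prems by (auto dest: inj_onD)
      then show "e \<in> {{u, v}}" using ab by simp
    qed
    show "{{u, v}} \<subseteq> ?A" using insert.prems by blast
  qed
  then have "cw_edges (Join (cw_label t u) (cw_label t v) t') =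
      cw_edges t \<union> {{u, v} | u. u \<in> N} \<union> {{u, v}}"
    using t' by simp
  also have "\<dots> = cw_edges t \<union> {{w, v} | w. w \<in> insert u N}" by auto
  finally show ?case
    using t' ne by (intro exI[of _ "Join (cw_label t u) (cw_label t v) t'"]) auto
qed

lemma ex_linear_cw_constructs:
  assumes "simple_graph G"
  shows "\<exists>t. cw_constructs t G \<and> cw_linear t"
proof -
  have "finite V \<Longrightarrow> V \<noteq> {} \<Longrightarrow> (\<forall>e\<in>E. e \<subseteq> V \<and> card e = 2) \<Longrightarrow> inj_on f V \<Longrightarrow>
    \<exists>t. cw_wf t \<and> cw_linear t \<and> cw_verts t = V \<and> cw_edges t = E \<and> (\<forall>v\<in>V. cw_label t v = f v)"
    for V :: "'a set" and E and f :: "'a \<Rightarrow> nat"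
  proof (induction V arbitrary: E rule: finite_ne_induct)
    case (singleton v)
    have "e = {} \<or> e = {v}" if "e \<in> E" for e
      using singleton that by blast
    then have "E = {}" using singleton by fastforce
    then show ?case by (intro exI[of _ "Create (f v) v"]) auto
  next
    case (insert v V)
    let ?E = "{e \<in> E. v \<notin> e}" and ?N = "{u. {u, v} \<in> E}"
    have "\<forall>e\<in>?E. e \<subseteq> V \<and> card e = 2" using insert.prems by auto
    moreover have "inj_on f V" using insert.prems by simp
    ultimately obtain t where t: "cw_wf t" "cw_linear t" "cw_verts t = V" "cw_edges t = ?E"
      "\<forall>x\<in>V. cw_label t x = f x"
      using insert.IH by meson
    let ?t = "DisjUnion t (Create (f v) v)"
    have lab: "\<forall>x\<in>insert v V. cw_label ?t x = f x" using t insert.hyps by auto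
    have "card {v, v} \<noteq> 2" by simp
    then have vN: "v \<notin> ?N" using insert.prems(1) by blast
    have N: "?N \<subseteq> V"
    proof
      fix u assume u: "u \<in> ?N"
      then have "u \<in> insert v V" using insert.prems(1) by blast
      then show "u \<in> V" using u vN by blast
    qed
    have "inj_on (cw_label ?t) (insert v V)"
      using insert.prems(2) lab unfolding inj_on_def by metis
    then have "inj_on (cw_label ?t) (cw_verts ?t)" using t by simp
    moreover have "cw_wf ?t" "cw_linear ?t" using t insert.hyps by (auto simp: is_Create_def)
    moreover have "finite ?N" using N insert.hyps finite_subset by blast
    moreover have "?N \<subseteq> cw_verts ?t" "v \<in> cw_verts ?t" using N t by auto
    ultimately obtain t' where t': "cw_wf t'" "cw_linear t'" "cw_verts t' = cw_verts ?t"
      "cw_label t' = cw_label ?t" "cw_edges t' = cw_edges ?t \<union> {{u, v} | u. u \<in> ?N}"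
      using ex_linear_joins[of ?N ?t v] vN by blast
    have "?E \<union> {{u, v} | u. u \<in> ?N} = E"
    proof -
      have "\<exists>u. e = {u, v}" if "e \<in> E" "v \<in> e" for e
      proof -
        have "card e = 2" using insert.prems that by blast
        then obtain a b where "e = {a, b}" by (auto simp: card_2_iff)
        then show ?thesis using that by blast
      qed
      then have "E \<subseteq> ?E \<union> {{u, v} | u. u \<in> ?N}" by fastforce
      moreover have "?E \<union> {{u, v} | u. u \<in> ?N} \<subseteq> E" by auto
      ultimately show ?thesis by (intro equalityI)
    qed
    then show ?case using t t' lab by (intro exI[of _ t']) auto
  qed
  note construct = this
  have fin: "finite (verts G)" and ne: "verts G \<noteq> {}"
    and E: "\<forall>e\<in>edges G. e \<subseteq> verts G \<and> card e = 2"
    using assms by (simp_all add: simple_graph_def)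
  obtain f :: "'a \<Rightarrow> nat" where "inj_on f (verts G)"
    using finite_imp_inj_to_nat_seg[OF fin] by auto
  from construct[OF fin ne E this] show ?thesis
    by (auto simp: cw_constructs_def)
qed

section \<open>Minimal classes of unbounded width\<close>

definition width_bounded :: "('a graph \<Rightarrow> nat) \<Rightarrow> 'a graph set \<Rightarrow> bool" where
  "width_bounded w X \<longleftrightarrow> (\<exists>c. \<forall>G\<in>X. w G \<le> c)"

definition minimal_hereditary_unbounded :: "('a graph \<Rightarrow> nat) \<Rightarrow> 'a graph set \<Rightarrow> bool" where
  "minimal_hereditary_unbounded w X \<longleftrightarrow>
     hereditary X \<and> \<not> width_bounded w X \<and>
     (\<forall>Y. hereditary Y \<and> Y \<subset> X \<longrightarrow> width_bounded w Y)"

end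

theory Submission
  imports Defs "HOL-Library.Product_Lexorder" "HOL-Library.Nat_Bijection"
begin

text \<open>
  Points of a grid are joined only if they lie in consecutive columns. Between columns \<open>c\<close> and
  \<open>c + 1\<close> the edges form the perfect matching of equal rows, except that for \<open>d dvd c\<close> they form
  its bipartite complement; the finite induced subgraphs make up the class for \<open>d\<close>.

  An expression with \<open>k\<close> labels yields a balanced vertex cut with at most \<open>k\<close> types of
  neighbourhoods across it. In a large full grid, a cut either splits many rows, or has a row
  on each side; then every complemented column pair has an edge across the cut. Both force many
  types, so clique-width is unbounded.

  If a graph of the class is missing from a hereditary subclass, then its members have only few
  full rows in every window of consecutive columns, since all such windows of the same sufficient
  width contain shifted copies of the missing graph. Ordering the vertices window by window, with
  every non-full row split at a gap, and row by row within a window, gives bounded linear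
  clique-width. The same ordering bounds the linear clique-width of graphs that are small
  compared to \<open>d\<close> by a constant, so that each class coincides with only finitely many others.
\<close>

section \<open>Linear expressions from vertex orderings\<close>

lemma finite_cw_labels: "finite (cw_labels t)"
  by (induction t) auto

lemma cw_edges_subset: "e \<in> cw_edges t \<Longrightarrow> e \<subseteq> cw_verts t"
  by (induction t) auto

lemma cw_label_in_cw_labels: "x \<in> cw_verts t \<Longrightarrow> cw_label t x \<in> cw_labels t"
  by (induction t) auto

lemma ex_join_label_set:
  assumes "finite I" "c \<notin> I" "cw_wf t" "cw_linear t"
  shows "\<exists>t'. cw_wf t' \<and> cw_linear t' \<and> cw_verts t' = cw_verts t \<and> cw_label t' = cw_label t \<and>
    cw_labels t' \<subseteq> cw_labels t \<union> insert c I \<and>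
    cw_edges t' = cw_edges t \<union> {{u, v} | u v. u \<in> cw_verts t \<and> v \<in> cw_verts t \<and>
      cw_label t u \<in> I \<and> cw_label t v = c}"
  using assms
proof (induction I rule: finite_induct)
  case empty
  then show ?case by (intro exI[of _ t]) auto
next
  case (insert i I)
  then obtain t' where "cw_wf t'" "cw_linear t'" "cw_verts t' = cw_verts t" "cw_label t' = cw_label t"
    "cw_labels t' \<subseteq> cw_labels t \<union> insert c I"
    "cw_edges t' = cw_edges t \<union> {{u, v} | u v. u \<in> cw_verts t \<and> v \<in> cw_verts t \<and>
      cw_label t u \<in> I \<and> cw_label t v = c}"
    by auto
  then show ?case using insert.prems by (intro exI[of _ "Join i c t'"]) auto
qed

text \<open>No target label lies in \<open>I\<close>, so no vertex is renamed twice and the single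
  renamings can be done in any order.\<close>

lemma ex_relabel_disjoint:
  assumes "finite I" "g ` I \<inter> I = {}" "cw_wf t" "cw_linear t"
  shows "\<exists>t'. cw_wf t' \<and> cw_linear t' \<and> cw_verts t' = cw_verts t \<and> cw_edges t' = cw_edges t \<and>
    cw_labels t' \<subseteq> cw_labels t \<union> I \<union> g ` I \<and>
    cw_label t' = (\<lambda>x. if cw_label t x \<in> I then g (cw_label t x) else cw_label t x)"
  using assms
proof (induction I rule: finite_induct)
  case empty
  then show ?case by (intro exI[of _ t]) auto
next
  case (insert i I)
  then obtain t' where t': "cw_wf t'" "cw_linear t'" "cw_verts t' = cw_verts t"
    "cw_edges t' = cw_edges t" "cw_labels t' \<subseteq> cw_labels t \<union> I \<union> g ` I"
    "cw_label t' = (\<lambda>x. if cw_label t x \<in> I then g (cw_label t x) else cw_label t x)"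
    by auto
  have "cw_label (Relabel i (g i) t') =
      (\<lambda>x. if cw_label t x \<in> insert i I then g (cw_label t x) else cw_label t x)"
    using insert.prems insert.hyps by (intro ext) (auto simp: t' split: if_splits)
  then show ?case using t' by (intro exI[of _ "Relabel i (g i) t'"]) auto
qed

text \<open>Passing through the fresh labels \<open>{M..<2 * M}\<close> keeps the single renamings from interfering.\<close>

lemma ex_relabel:
  assumes "cw_wf t" "cw_linear t" "\<And>x. x \<in> cw_verts t \<Longrightarrow> cw_label t x < M"
    "\<And>l. l < M \<Longrightarrow> h l < M" "cw_labels t \<subseteq> {..<2 * M}"
  shows "\<exists>t'. cw_wf t' \<and> cw_linear t' \<and> cw_verts t' = cw_verts t \<and> cw_edges t' = cw_edges t \<and>
    cw_labels t' \<subseteq> {..<2 * M} \<and> (\<forall>x\<in>cw_verts t. cw_label t' x = h (cw_label t x))"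
proof -
  obtain t1 where t1: "cw_wf t1" "cw_linear t1" "cw_verts t1 = cw_verts t"
    "cw_edges t1 = cw_edges t" "cw_labels t1 \<subseteq> cw_labels t \<union> {..<M} \<union> (\<lambda>l. M + h l) ` {..<M}"
    "cw_label t1 = (\<lambda>x. if cw_label t x \<in> {..<M} then M + h (cw_label t x) else cw_label t x)"
    using ex_relabel_disjoint[of "{..<M}" "\<lambda>l. M + h l" t] assms(1,2) by auto
  have "(\<lambda>l. l - M) ` {M..<2 * M} \<inter> {M..<2 * M} = {}" by auto
  then obtain t2 where t2: "cw_wf t2" "cw_linear t2" "cw_verts t2 = cw_verts t1"
    "cw_edges t2 = cw_edges t1"
    "cw_labels t2 \<subseteq> cw_labels t1 \<union> {M..<2 * M} \<union> (\<lambda>l. l - M) ` {M..<2 * M}"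
    "cw_label t2 = (\<lambda>x. if cw_label t1 x \<in> {M..<2 * M} then cw_label t1 x - M else cw_label t1 x)"
    using ex_relabel_disjoint[of "{M..<2 * M}" "\<lambda>l. l - M" t1] t1(1,2) by auto
  have "cw_labels t1 \<subseteq> {..<2 * M}"
    using t1(5) assms(4,5) by fastforce
  then have "cw_labels t2 \<subseteq> {..<2 * M}"
    using t2(5) by fastforce
  moreover have "\<forall>x\<in>cw_verts t. cw_label t2 x = h (cw_label t x)"
    using assms(3,4) by (auto simp: t1(6) t2(6))
  ultimately show ?thesis
    using t1 t2 by (intro exI[of _ t2]) auto
qed

text \<open>The vertices are created in the order of \<open>\<kappa>\<close>. The induction passes
  from the predecessor of \<open>v\<close> to \<open>v\<close> and keeps the invariant that equal
  labels imply equal neighbourhoods among the later vertices. Each prefix has at most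
  \<open>K\<close> such neighbourhoods, so after each step the labels can be compressed to numbers
  below \<open>K\<close>; label \<open>K\<close> is kept for the vertex being created, and the
  \<open>Suc K\<close> labels are doubled to leave room for the renaming.\<close>

lemma ex_linear_prefix:
  fixes G :: "'a graph" and \<kappa> :: "'a \<Rightarrow> 'k::linorder"
  assumes G: "simple_graph G" and inj: "inj_on \<kappa> (verts G)"
    and types: "\<And>v. v \<in> verts G \<Longrightarrow>
      card ((\<lambda>u. {z \<in> verts G. \<kappa> v < \<kappa> z \<and> {u, z} \<in> edges G}) ` {u \<in> verts G. \<kappa> u \<le> \<kappa> v}) \<le> K"
    and v: "v \<in> verts G"
  shows "\<exists>t. cw_wf t \<and> cw_linear t \<and> cw_verts t = {u \<in> verts G. \<kappa> u \<le> \<kappa> v} \<and>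
    cw_edges t = {e \<in> edges G. e \<subseteq> cw_verts t} \<and> cw_labels t \<subseteq> {..<2 * Suc K} \<and>
    (\<forall>x\<in>cw_verts t. cw_label t x < K) \<and>
    (\<forall>x\<in>cw_verts t. \<forall>y\<in>cw_verts t. cw_label t x = cw_label t y \<longrightarrow>
      (\<forall>z\<in>verts G. \<kappa> v < \<kappa> z \<longrightarrow> {x, z} \<in> edges G \<longleftrightarrow> {y, z} \<in> edges G))"
  using v
proof (induction "card {u \<in> verts G. \<kappa> u < \<kappa> v}" arbitrary: v rule: less_induct)
  case less
  let ?V = "verts G" and ?E = "edges G"
  let ?N = "\<lambda>u. {z \<in> ?V. \<kappa> v < \<kappa> z \<and> {u, z} \<in> ?E}" and ?P = "{u \<in> ?V. \<kappa> u \<le> \<kappa> v}"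
  have fin: "finite ?V" and E: "\<And>e. e \<in> ?E \<Longrightarrow> e \<subseteq> ?V \<and> card e = 2"
    using G by (auto simp: simple_graph_def)
  have no_loop: "{x} \<notin> ?E" for x
    using E[of "{x}"] by auto
  have finN: "finite (?N ` ?P)" using fin by simp
  \<comment> \<open>The neighbourhoods that occur are numbered; their numbers will be the labels
    after this step.\<close>
  obtain idx :: "'a set \<Rightarrow> nat" where idx: "bij_betw idx (?N ` ?P) {0..<card (?N ` ?P)}"
    using ex_bij_betw_finite_nat[OF finN] by auto
  have idxK: "idx (?N u) < K" if "u \<in> ?P" for u
  proof -
    have "idx (?N u) \<in> {0..<card (?N ` ?P)}"
      using idx that by (auto simp: bij_betw_def)
    then show ?thesis using types[OF less.prems] by auto
  qed
  have idx_eq: "?N x = ?N y" if "idx (?N x) = idx (?N y)" "x \<in> ?P" "y \<in> ?P" for x y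
    using idx that unfolding bij_betw_def by (meson image_eqI inj_onD)
  have vP: "v \<in> ?P" using less.prems by simp
  show ?case
  proof (cases "{u \<in> ?V. \<kappa> u < \<kappa> v} = {}")
    case True
    have P: "?P = {v}"
      using True inj less.prems by (auto simp: le_less dest: inj_onD)
    have "{e \<in> ?E. e \<subseteq> {v}} = {}"
      using E by (auto simp: subset_singleton_iff no_loop) (metis E card.empty zero_neq_numeral)
    \<comment> \<open>Here \<open>idxK\<close> at \<open>v\<close> is used only to get
      \<open>0 < K\<close>, which makes 0 an admissible label.\<close>
    then show ?thesis
      using P idxK[OF vP] by (intro exI[of _ "Create 0 v"]) auto
  next
    case False
    have "finite (\<kappa> ` {u \<in> ?V. \<kappa> u < \<kappa> v})" using fin by simp
    then have "Max (\<kappa> ` {u \<in> ?V. \<kappa> u < \<kappa> v}) \<in> \<kappa> ` {u \<in> ?V. \<kappa> u < \<kappa> v}"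
      using False Max_in by blast
    then obtain p where p: "p \<in> ?V" "\<kappa> p < \<kappa> v" "\<kappa> p = Max (\<kappa> ` {u \<in> ?V. \<kappa> u < \<kappa> v})"
      by auto
    have p_max: "\<kappa> u \<le> \<kappa> p" if "u \<in> ?V" "\<kappa> u < \<kappa> v" for u
      using that fin p(3) by simp
    have pre: "{u \<in> ?V. \<kappa> u < \<kappa> v} = {u \<in> ?V. \<kappa> u \<le> \<kappa> p}"
      using p_max p(2) by auto
    have "{u \<in> ?V. \<kappa> u < \<kappa> p} \<subset> {u \<in> ?V. \<kappa> u < \<kappa> v}"
      using p(1,2) by auto
    then have "card {u \<in> ?V. \<kappa> u < \<kappa> p} < card {u \<in> ?V. \<kappa> u < \<kappa> v}"
      using fin by (intro psubset_card_mono) auto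
    from less.hyps[OF this p(1)] obtain t where
      t: "cw_wf t" "cw_linear t" and tV: "cw_verts t = {u \<in> ?V. \<kappa> u \<le> \<kappa> p}"
      and tE: "cw_edges t = {e \<in> ?E. e \<subseteq> cw_verts t}" and tL: "cw_labels t \<subseteq> {..<2 * Suc K}"
      and tK: "\<And>x. x \<in> cw_verts t \<Longrightarrow> cw_label t x < K"
      and tN: "\<And>x y z. x \<in> cw_verts t \<Longrightarrow> y \<in> cw_verts t \<Longrightarrow> cw_label t x = cw_label t y \<Longrightarrow>
        z \<in> ?V \<Longrightarrow> \<kappa> p < \<kappa> z \<Longrightarrow> {x, z} \<in> ?E \<longleftrightarrow> {y, z} \<in> ?E"
      by blast
    have vt: "v \<notin> cw_verts t" using tV p by auto
    have P: "?P = insert v (cw_verts t)"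
    proof -
      have "?P = insert v {u \<in> ?V. \<kappa> u < \<kappa> v}"
        using less.prems inj by (auto simp: le_less dest: inj_onD)
      then show ?thesis using pre tV by simp
    qed
    \<comment> \<open>Label \<open>K\<close> does not occur on the earlier vertices, so
      \<open>v\<close> is the only vertex carrying it. By the invariant each old label class is
      completely adjacent or completely nonadjacent to \<open>v\<close>; joining \<open>K\<close>
      with the labels of the neighbours of \<open>v\<close> therefore adds exactly the missing
      edges.\<close>
    let ?s = "DisjUnion t (Create K v)" and ?I = "{cw_label t u | u. u \<in> cw_verts t \<and> {u, v} \<in> ?E}"
    have I: "?I \<subseteq> {..<K}" using tK by auto
    have s: "cw_wf ?s" "cw_linear ?s" using t vt by (auto simp: is_Create_def)
    obtain r where r: "cw_wf r" "cw_linear r" "cw_verts r = cw_verts ?s" "cw_label r = cw_label ?s"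
      "cw_labels r \<subseteq> cw_labels ?s \<union> insert K ?I"
      "cw_edges r = cw_edges ?s \<union> {{a, b} | a b. a \<in> cw_verts ?s \<and> b \<in> cw_verts ?s \<and>
        cw_label ?s a \<in> ?I \<and> cw_label ?s b = K}"
      using ex_join_label_set[OF _ _ s, of ?I K] I finite_subset[OF I] by fastforce
    have new: "{{a, b} | a b. a \<in> cw_verts ?s \<and> b \<in> cw_verts ?s \<and>
        cw_label ?s a \<in> ?I \<and> cw_label ?s b = K} = {{a, v} | a. a \<in> cw_verts t \<and> {a, v} \<in> ?E}"
      (is "?A = ?B")
    proof
      show "?A \<subseteq> ?B"
      proof
        fix e assume "e \<in> ?A"
        then obtain a b where e: "e = {a, b}" "a \<in> cw_verts ?s" "b \<in> cw_verts ?s"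
          "cw_label ?s a \<in> ?I" "cw_label ?s b = K" by auto
        have b: "b = v" using e(3,5) tK by (auto split: if_splits)
        have a: "a \<in> cw_verts t" using e(2,4) I by (auto split: if_splits)
        then obtain u where "u \<in> cw_verts t" "{u, v} \<in> ?E" "cw_label t a = cw_label t u"
          using e(4) by auto
        then have "{a, v} \<in> ?E" using tN[of a u v] a less.prems p(2) by auto
        then show "e \<in> ?B" using e(1) a b by auto
      qed
      show "?B \<subseteq> ?A"
        using vt by (fastforce simp: insert_commute)
    qed
    have rE: "cw_edges r = {e \<in> ?E. e \<subseteq> ?P}"
    proof
      show "cw_edges r \<subseteq> {e \<in> ?E. e \<subseteq> ?P}"
        unfolding r(6) new P using tE by auto
      show "{e \<in> ?E. e \<subseteq> ?P} \<subseteq> cw_edges r"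
      proof
        fix e assume e: "e \<in> {e \<in> ?E. e \<subseteq> ?P}"
        show "e \<in> cw_edges r"
        proof (cases "v \<in> e")
          case True
          from e E have "card e = 2" by blast
          then obtain a where a: "e = {a, v}" "a \<noteq> v" using True
            by (auto simp: card_2_iff)
          then show ?thesis unfolding r(6) new using e P by auto
        next
          case False
          then show ?thesis unfolding r(6) using e P tE by auto
        qed
      qed
    qed
    have lab: "cw_label r x = (if x = v then K else cw_label t x)" if "x \<in> ?P" for x
      using that P vt r(4) by auto
    \<comment> \<open>The labels of \<open>r\<close> may separate vertices with equal later
      neighbourhoods, but never mix different ones. Any vertex with label \<open>l\<close> thus
      determines the number to which \<open>l\<close> must be renamed.\<close>
    define rep where "rep l = (SOME u. u \<in> ?P \<and> cw_label r u = l)" for l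
    have rep: "rep (cw_label r u) \<in> ?P \<and> cw_label r (rep (cw_label r u)) = cw_label r u"
      if "u \<in> ?P" for u
      unfolding rep_def using someI[of "\<lambda>w. w \<in> ?P \<and> cw_label r w = cw_label r u" u] that by blast
    have repN: "?N (rep (cw_label r u)) = ?N u" if u: "u \<in> ?P" for u
    proof -
      let ?w = "rep (cw_label r u)"
      have w: "?w \<in> ?P" "cw_label r ?w = cw_label r u" using rep[OF u] by auto
      have "?w = v \<longleftrightarrow> u = v"
        using w u lab[OF w(1)] lab[OF u] P tK by (metis insertE less_irrefl)
      then show ?thesis
      proof (cases "u = v")
        case False
        with \<open>?w = v \<longleftrightarrow> u = v\<close> have "cw_label t ?w = cw_label t u" "?w \<in> cw_verts t" "u \<in> cw_verts t"
          using w u lab[OF w(1)] lab[OF u] P by auto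
        then show ?thesis using tN[of ?w u] p(2) by auto
      qed auto
    qed
    \<comment> \<open>The value 0 on labels that no vertex carries only keeps \<open>h\<close> below
      \<open>Suc K\<close>, as \<open>ex_relabel\<close> demands.\<close>
    define h where "h l = (if \<exists>u\<in>?P. cw_label r u = l then idx (?N (rep l)) else 0)" for l
    have h: "h (cw_label r u) = idx (?N u)" if "u \<in> ?P" for u
      using that repN[OF that] unfolding h_def by auto
    have hK: "h l < Suc K" for l
    proof (cases "\<exists>u\<in>?P. cw_label r u = l")
      case True
      then obtain u where u: "u \<in> ?P" "cw_label r u = l" by blast
      then show ?thesis using h[OF u(1)] idxK[OF u(1)] by simp
    qed (simp add: h_def)
    have rP: "cw_verts r = ?P" using r(3) P by simp
    have rK: "cw_label r x < Suc K" if "x \<in> cw_verts r" for x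
      using that lab[of x] tK[of x] P rP by (cases "x = v") auto
    have "?I \<subseteq> {..<2 * Suc K}" "K \<in> {..<2 * Suc K}"
      using I by (rule order_trans) auto
    then have rL: "cw_labels r \<subseteq> {..<2 * Suc K}"
      using r(5) tL unfolding cw_labels.simps by blast
    obtain q where q: "cw_wf q" "cw_linear q" "cw_verts q = ?P"
      "cw_edges q = cw_edges r" "cw_labels q \<subseteq> {..<2 * Suc K}"
      "\<And>x. x \<in> ?P \<Longrightarrow> cw_label q x = h (cw_label r x)"
      using ex_relabel[where h = h, OF r(1,2) rK hK rL] unfolding rP by blast
    have qN: "{x, z} \<in> ?E \<longleftrightarrow> {y, z} \<in> ?E"
      if "x \<in> ?P" "y \<in> ?P" "cw_label q x = cw_label q y" "z \<in> ?V" "\<kappa> v < \<kappa> z" for x y z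
    proof -
      have "?N x = ?N y" using idx_eq[of x y] that q(6) h by simp
      then show ?thesis using that by blast
    qed
    have qK: "cw_label q x < K" if "x \<in> ?P" for x
      using q(6)[OF that] h[OF that] idxK[OF that] by simp
    show ?thesis
      apply (intro exI[of _ q] conjI ballI impI)
      subgoal by (fact q(1))
      subgoal by (fact q(2))
      subgoal by (fact q(3))
      subgoal unfolding q(4) rE q(3) ..
      subgoal by (fact q(5))
      subgoal unfolding q(3) by (rule qK)
      subgoal unfolding q(3) by (rule qN)
      done
  qed
qed

text \<open>The prefix ending in the vertex with the largest key is the whole graph.\<close>

lemma lcwd_le_linear_layout:
  fixes G :: "'a graph" and \<kappa> :: "'a \<Rightarrow> 'k::linorder"
  assumes G: "simple_graph G" and inj: "inj_on \<kappa> (verts G)"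
    and types: "\<And>v. v \<in> verts G \<Longrightarrow>
      card ((\<lambda>u. {z \<in> verts G. \<kappa> v < \<kappa> z \<and> {u, z} \<in> edges G}) ` {u \<in> verts G. \<kappa> u \<le> \<kappa> v}) \<le> K"
  shows "lcwd G \<le> 2 * Suc K"
proof -
  have V: "finite (verts G)" "verts G \<noteq> {}" and E: "\<And>e. e \<in> edges G \<Longrightarrow> e \<subseteq> verts G"
    using G by (auto simp: simple_graph_def)
  then have "Max (\<kappa> ` verts G) \<in> \<kappa> ` verts G" by (intro Max_in) auto
  then obtain v where v: "v \<in> verts G" "\<kappa> v = Max (\<kappa> ` verts G)" by auto
  have *: "{u \<in> verts G. \<kappa> u \<le> \<kappa> v} = verts G" using v V by auto
  from ex_linear_prefix[OF G inj types v(1)] obtain t where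
    t: "cw_wf t" "cw_linear t" "cw_verts t = {u \<in> verts G. \<kappa> u \<le> \<kappa> v}"
    "cw_edges t = {e \<in> edges G. e \<subseteq> cw_verts t}" "cw_labels t \<subseteq> {..<2 * Suc K}"
    by blast
  moreover have "{e \<in> edges G. e \<subseteq> verts G} = edges G"
    using E by blast
  ultimately have "cw_constructs t G"
    using * by (simp add: cw_constructs_def)
  then have "lcwd G \<le> card (cw_labels t)"
    unfolding lcwd_def using t(2) by (intro Least_le) auto
  also have "\<dots> \<le> card {..<2 * Suc K}"
    using t(5) by (intro card_mono) auto
  finally show ?thesis by simp
qed

section \<open>Balanced cuts of small clique-width\<close>

lemma ex_cw_constructs_cwd:
  assumes "simple_graph G"
  shows "\<exists>t. cw_constructs t G \<and> card (cw_labels t) = cwd G"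
  unfolding cwd_def using ex_linear_cw_constructs[OF assms]
  by (intro LeastI_ex[of "\<lambda>k. \<exists>t. cw_constructs t G \<and> card (cw_labels t) = k"]) blast

lemma cwd_le_lcwd:
  assumes "simple_graph G"
  shows "cwd G \<le> lcwd G"
proof -
  have "\<exists>t. cw_constructs t G \<and> cw_linear t \<and> card (cw_labels t) = lcwd G"
    unfolding lcwd_def using ex_linear_cw_constructs[OF assms]
    by (intro LeastI_ex[of "\<lambda>k. \<exists>t. cw_constructs t G \<and> cw_linear t \<and> card (cw_labels t) = k"]) blast
  then show ?thesis
    unfolding cwd_def[of G] by (intro Least_le) blast
qed

text \<open>\<open>S\<close> plays the vertex set of a subexpression and \<open>l\<close> its labels
  there. Equality of the current labels in \<open>t\<close> is part of the definition because it
  makes the condition on outer neighbours survive further joins.\<close>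

definition label_cut :: "'a cw_expr \<Rightarrow> 'a set \<Rightarrow> ('a \<Rightarrow> nat) \<Rightarrow> bool" where
  "label_cut t S l \<longleftrightarrow> S \<subseteq> cw_verts t \<and> l ` S \<subseteq> cw_labels t \<and>
    (\<forall>x\<in>S. \<forall>y\<in>S. l x = l y \<longrightarrow> cw_label t x = cw_label t y \<and>
      (\<forall>z\<in>cw_verts t - S. {x, z} \<in> cw_edges t \<longleftrightarrow> {y, z} \<in> cw_edges t))"

lemma label_cutI:
  assumes "S \<subseteq> cw_verts t" "\<And>x. x \<in> S \<Longrightarrow> l x \<in> cw_labels t"
    "\<And>x y. x \<in> S \<Longrightarrow> y \<in> S \<Longrightarrow> l x = l y \<Longrightarrow> cw_label t x = cw_label t y"
    "\<And>x y z. x \<in> S \<Longrightarrow> y \<in> S \<Longrightarrow> l x = l y \<Longrightarrow> z \<in> cw_verts t \<Longrightarrow> z \<notin> S \<Longrightarrow>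
      {x, z} \<in> cw_edges t \<longleftrightarrow> {y, z} \<in> cw_edges t"
  shows "label_cut t S l"
  unfolding label_cut_def
  by (intro conjI ballI impI image_subsetI assms(1))
    (assumption | rule assms(2) | rule assms(3) | rule assms(4) | (erule DiffE, assumption))+

lemma label_cutD:
  assumes "label_cut t S l"
  shows "x \<in> S \<Longrightarrow> x \<in> cw_verts t" "x \<in> S \<Longrightarrow> l x \<in> cw_labels t"
    "x \<in> S \<Longrightarrow> y \<in> S \<Longrightarrow> l x = l y \<Longrightarrow> cw_label t x = cw_label t y"
    "x \<in> S \<Longrightarrow> y \<in> S \<Longrightarrow> l x = l y \<Longrightarrow> z \<in> cw_verts t \<Longrightarrow> z \<notin> S \<Longrightarrow>
      {x, z} \<in> cw_edges t \<longleftrightarrow> {y, z} \<in> cw_edges t"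
proof -
  note cut = assms[unfolded label_cut_def]
  note types = cut[THEN conjunct2, THEN conjunct2, rule_format]
  show "x \<in> S \<Longrightarrow> x \<in> cw_verts t"
    using cut[THEN conjunct1] by (rule subsetD)
  show "x \<in> S \<Longrightarrow> l x \<in> cw_labels t"
    using cut[THEN conjunct2, THEN conjunct1] by blast
  show "x \<in> S \<Longrightarrow> y \<in> S \<Longrightarrow> l x = l y \<Longrightarrow> cw_label t x = cw_label t y"
    by (rule types[THEN conjunct1])
  show "x \<in> S \<Longrightarrow> y \<in> S \<Longrightarrow> l x = l y \<Longrightarrow> z \<in> cw_verts t \<Longrightarrow> z \<notin> S \<Longrightarrow>
      {x, z} \<in> cw_edges t \<longleftrightarrow> {y, z} \<in> cw_edges t"
    by (rule types[THEN conjunct2, rule_format]) (assumption | rule DiffI)+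
qed

lemma label_cut_verts: "label_cut t (cw_verts t) (cw_label t)"
  by (rule label_cutI) (auto intro: cw_label_in_cw_labels)

lemma label_cut_DisjUnion:
  assumes cut: "label_cut s S l" and disj: "cw_verts s \<inter> cw_verts t = {}"
  shows "label_cut (DisjUnion s t) S l" "label_cut (DisjUnion t s) S l"
proof -
  note c = label_cutD[OF cut]
  have t: "{x, z} \<notin> cw_edges t" if "x \<in> S" for x z
    using c(1)[OF that] cw_edges_subset[of "{x, z}" t] disj by auto
  have s: "{x, z} \<notin> cw_edges s" if "z \<notin> cw_verts s" for x z
    using that cw_edges_subset[of "{x, z}" s] by auto
  have lab: "cw_label (DisjUnion t s) x = cw_label s x" if "x \<in> S" for x
    using c(1)[OF that] disj by auto
  show "label_cut (DisjUnion s t) S l"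
  proof (rule label_cutI)
    fix x y z assume "x \<in> S" "y \<in> S" "l x = l y" "z \<notin> S"
    then show "{x, z} \<in> cw_edges (DisjUnion s t) \<longleftrightarrow> {y, z} \<in> cw_edges (DisjUnion s t)"
      using c(4)[of x y z] s[of z] t[of x z] t[of y z] by (cases "z \<in> cw_verts s") auto
  next
    fix x y assume "x \<in> S" "y \<in> S" "l x = l y"
    then show "cw_label (DisjUnion s t) x = cw_label (DisjUnion s t) y"
      using c(1)[of x] c(1)[of y] c(3)[of x y] by simp
  qed (auto dest: c(1,2))
  show "label_cut (DisjUnion t s) S l"
  proof (rule label_cutI)
    fix x y z assume "x \<in> S" "y \<in> S" "l x = l y" "z \<notin> S"
    then show "{x, z} \<in> cw_edges (DisjUnion t s) \<longleftrightarrow> {y, z} \<in> cw_edges (DisjUnion t s)"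
      using c(4)[of x y z] s[of z] t[of x z] t[of y z] by (cases "z \<in> cw_verts s") auto
  next
    fix x y assume "x \<in> S" "y \<in> S" "l x = l y"
    then show "cw_label (DisjUnion t s) x = cw_label (DisjUnion t s) y"
      using c(3)[of x y] lab[of x] lab[of y] by simp
  qed (auto dest: c(1,2))
qed

text \<open>Vertices of \<open>S\<close> with equal \<open>l\<close> have equal current labels, so a
  join treats them alike.\<close>

lemma label_cut_Join:
  assumes "label_cut t S l"
  shows "label_cut (Join i j t) S l"
proof -
  note c = label_cutD[OF assms]
  have mem: "{x, z} \<in> cw_edges (Join i j t) \<longleftrightarrow> {x, z} \<in> cw_edges t \<or>
      cw_label t x = i \<and> cw_label t z = j \<or> cw_label t x = j \<and> cw_label t z = i"
    if "x \<in> S" "z \<in> cw_verts t" for x z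
  proof -
    have "x \<in> cw_verts t" using that c(1) by simp
    then show ?thesis using that(2) by (simp add: doubleton_eq_iff) blast
  qed
  show ?thesis
  proof (rule label_cutI)
    fix x y z assume "x \<in> S" "y \<in> S" "l x = l y" "z \<in> cw_verts (Join i j t)" "z \<notin> S"
    then show "{x, z} \<in> cw_edges (Join i j t) \<longleftrightarrow> {y, z} \<in> cw_edges (Join i j t)"
      using c(3)[of x y] c(4)[of x y z] mem[of x z] mem[of y z] by simp
  qed (auto dest: c(1,2) intro: c(3))
qed

lemma label_cut_Relabel:
  assumes "label_cut t S l"
  shows "label_cut (Relabel i j t) S l"
proof (rule label_cutI)
  note c = label_cutD[OF assms]
  fix x y assume "x \<in> S" "y \<in> S" "l x = l y"
  then show "cw_label (Relabel i j t) x = cw_label (Relabel i j t) y"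
    using c(3)[of x y] by simp
next
  fix x y z assume "x \<in> S" "y \<in> S" "l x = l y" "z \<in> cw_verts (Relabel i j t)" "z \<notin> S"
  then show "{x, z} \<in> cw_edges (Relabel i j t) \<longleftrightarrow> {y, z} \<in> cw_edges (Relabel i j t)"
    using label_cutD(4)[OF assms, of x y z] by simp
qed (auto dest: label_cutD(1,2)[OF assms])

text \<open>Descend from the root until fewer than \<open>2 * m\<close> vertices remain. A union
  with at least \<open>2 * m\<close> vertices has an operand with at least \<open>m\<close>, and a
  cut found in a subexpression remains one in the larger expression.\<close>

lemma ex_balanced_label_cut:
  assumes "cw_wf t" "1 \<le> m" "m \<le> card (cw_verts t)"
  shows "\<exists>S l. label_cut t S l \<and> m \<le> card S \<and> card S < 2 * m"
  using assms
proof (induction t)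
  case (Create i v)
  then show ?case
    using label_cut_verts[of "Create i v"]
    by (intro exI[of _ "{v}"] exI[of _ "\<lambda>_. i"]) auto
next
  case (DisjUnion s t)
  show ?case
  proof (cases "card (cw_verts (DisjUnion s t)) < 2 * m")
    case True
    then show ?thesis using DisjUnion.prems label_cut_verts by blast
  next
    case False
    then have "m \<le> card (cw_verts s) \<or> m \<le> card (cw_verts t)"
      using card_Un_le[of "cw_verts s" "cw_verts t"] by auto
    moreover have "cw_wf s" "cw_wf t" "cw_verts s \<inter> cw_verts t = {}" "cw_verts t \<inter> cw_verts s = {}"
      using DisjUnion.prems by auto
    ultimately show ?thesis
      using DisjUnion.IH DisjUnion.prems(2) label_cut_DisjUnion by meson
  qed
next
  case (Join i j t)
  then have "\<exists>S l. label_cut t S l \<and> m \<le> card S \<and> card S < 2 * m" by simp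
  then show ?case using label_cut_Join by blast
next
  case (Relabel i j t)
  then have "\<exists>S l. label_cut t S l \<and> m \<le> card S \<and> card S < 2 * m" by simp
  then show ?case using label_cut_Relabel by blast
qed

section \<open>Grid graphs\<close>

text \<open>Grid points are pairs (row, column).\<close>

definition grid_adj :: "nat \<Rightarrow> nat \<times> nat \<Rightarrow> nat \<times> nat \<Rightarrow> bool" where
  "grid_adj d p q \<longleftrightarrow>
    snd q = Suc (snd p) \<and> (fst p = fst q \<longleftrightarrow> \<not> d dvd snd p) \<or>
    snd p = Suc (snd q) \<and> (fst p = fst q \<longleftrightarrow> \<not> d dvd snd q)"

definition grid_embedding :: "nat \<Rightarrow> 'a graph \<Rightarrow> ('a \<Rightarrow> nat \<times> nat) \<Rightarrow> bool" where
  "grid_embedding d G f \<longleftrightarrow> inj_on f (verts G) \<and>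
    (\<forall>u\<in>verts G. \<forall>v\<in>verts G. {u, v} \<in> edges G \<longleftrightarrow> grid_adj d (f u) (f v))"

definition grid_class :: "nat \<Rightarrow> 'a graph set" where
  "grid_class d = {G. simple_graph G \<and> (\<exists>f. grid_embedding d G f)}"

lemma grid_adj_sym: "grid_adj d p q \<longleftrightarrow> grid_adj d q p"
  by (auto simp: grid_adj_def)

lemma grid_adj_irrefl: "\<not> grid_adj d p p"
  by (simp add: grid_adj_def)

lemma grid_adj_Suc: "grid_adj d (r, c) (r', Suc c) \<longleftrightarrow> (r = r' \<longleftrightarrow> \<not> d dvd c)"
  by (simp add: grid_adj_def)

lemma simple_graph_induced_subgraph:
  assumes "simple_graph G" "S \<subseteq> verts G" "S \<noteq> {}"
  shows "simple_graph (induced_subgraph G S)"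
  using assms finite_subset by (auto simp: simple_graph_def induced_subgraph_def)

text \<open>An embedding is composed with the inverse of an isomorphism, or restricted to the chosen
  vertices.\<close>

lemma hereditary_grid_class: "hereditary (grid_class d :: 'a graph set)"
  unfolding hereditary_def graph_class_def
proof (intro conjI ballI allI impI)
  fix G :: "'a graph" assume "G \<in> grid_class d"
  then show "simple_graph G" by (simp add: grid_class_def)
next
  fix G H :: "'a graph" assume G: "G \<in> grid_class d" and H: "simple_graph H \<and> graph_iso G H"
  from G obtain f where f: "inj_on f (verts G)"
    "\<And>u v. u \<in> verts G \<Longrightarrow> v \<in> verts G \<Longrightarrow> {u, v} \<in> edges G \<longleftrightarrow> grid_adj d (f u) (f v)"
    by (auto simp: grid_class_def grid_embedding_def)
  from H obtain h where h: "bij_betw h (verts G) (verts H)"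
    "\<And>u v. u \<in> verts G \<Longrightarrow> v \<in> verts G \<Longrightarrow> {u, v} \<in> edges G \<longleftrightarrow> {h u, h v} \<in> edges H"
    by (auto simp: graph_iso_def)
  let ?g = "inv_into (verts G) h"
  have g: "?g w \<in> verts G" "h (?g w) = w" if "w \<in> verts H" for w
    using h(1) that by (auto simp: bij_betw_def inv_into_into f_inv_into_f)
  have "inj_on (f \<circ> ?g) (verts H)"
    by (rule inj_onI) (metis comp_apply f(1) g inj_onD)
  moreover have "{u, v} \<in> edges H \<longleftrightarrow> grid_adj d ((f \<circ> ?g) u) ((f \<circ> ?g) v)"
    if "u \<in> verts H" "v \<in> verts H" for u v
    using f(2)[of "?g u" "?g v"] h(2)[of "?g u" "?g v"] g that by simp
  ultimately have "grid_embedding d H (f \<circ> ?g)"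
    by (simp add: grid_embedding_def)
  then show "H \<in> grid_class d" using H by (auto simp: grid_class_def)
next
  fix G :: "'a graph" and S assume G: "G \<in> grid_class d" and S: "S \<subseteq> verts G \<and> S \<noteq> {}"
  then obtain f where f: "grid_embedding d G f" "simple_graph G"
    by (auto simp: grid_class_def)
  then have "grid_embedding d (induced_subgraph G S) f"
    using S by (auto simp: grid_embedding_def induced_subgraph_def subset_iff intro: inj_on_subset)
  then show "induced_subgraph G S \<in> grid_class d"
    using simple_graph_induced_subgraph[OF f(2)] S by (auto simp: grid_class_def)
qed

lemma ex_grid_class_graph:
  assumes "finite F" "F \<noteq> {}"
  shows "\<exists>(G :: nat graph) f. G \<in> grid_class d \<and> grid_embedding d G f \<and> f ` verts G = F"
proof -
  let ?E = "{{prod_encode p, prod_encode q} | p q. p \<in> F \<and> q \<in> F \<and> grid_adj d p q}"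
  let ?G = "(prod_encode ` F, ?E)"
  have enc: "prod_encode p = prod_encode q \<longleftrightarrow> p = q" for p q
    using inj_prod_encode[of UNIV] by (auto dest: injD)
  have "card {prod_encode p, prod_encode q} = 2" if "grid_adj d p q" for p q
  proof -
    have "p \<noteq> q" using that grid_adj_irrefl by blast
    then show ?thesis by (simp add: enc)
  qed
  then have "simple_graph ?G"
    using assms unfolding simple_graph_def by auto
  moreover have "{prod_encode p, prod_encode q} \<in> ?E \<longleftrightarrow> grid_adj d p q" if "p \<in> F" "q \<in> F" for p q
    unfolding mem_Collect_eq doubleton_eq_iff enc using that grid_adj_sym[of d p q] by blast
  then have "grid_embedding d ?G prod_decode"
    unfolding grid_embedding_def by (auto simp: inj_on_def)
  moreover have "prod_decode ` verts ?G = F"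
    by (simp add: image_image)
  ultimately show ?thesis
    unfolding grid_class_def by blast
qed

section \<open>Grids have large clique-width\<close>

text \<open>\<open>S\<close> is one side of a cut of the \<open>R\<close> by \<open>C\<close> grid
  with at most \<open>k\<close> types of neighbourhoods across it: points of \<open>S\<close> that
  are pairwise distinguished by points outside \<open>S\<close> number at most \<open>k\<close>.
  Families indexed by naturals allow rows or columns as indices; finiteness is demanded because
  infinite sets have cardinality 0.\<close>

locale grid_cut =
  fixes d R C k :: nat and S :: "(nat \<times> nat) set"
  assumes few_types: "a ` T \<subseteq> S \<Longrightarrow>
    (\<And>i j. i \<in> T \<Longrightarrow> j \<in> T \<Longrightarrow> i \<noteq> j \<Longrightarrow>
      \<exists>z\<in>{..<R} \<times> {..<C} - S. grid_adj d (a i) z \<noteq> grid_adj d (a j) z) \<Longrightarrow>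
    finite (T :: nat set) \<and> card T \<le> k"
begin

definition crossing :: "nat \<Rightarrow> bool" where
  "crossing c \<longleftrightarrow> Suc c < C \<and> (\<exists>r<R. \<exists>r'<R. grid_adj d (r, c) (r', Suc c) \<and>
    ((r, c) \<in> S) \<noteq> ((r', Suc c) \<in> S))"

text \<open>For \<open>d dvd c\<close> the two points are nonadjacent, so a cut row is not itself an
  edge across the cut.\<close>

definition cut_row :: "nat \<Rightarrow> nat \<Rightarrow> bool" where
  "cut_row c r \<longleftrightarrow> ((r, c) \<in> S) \<noteq> ((r, Suc c) \<in> S)"

text \<open>
  Edges between columns \<open>c, c + 1\<close> and \<open>c', c' + 1\<close> with \<open>c \<equiv> c'\<close> modulo 3 do not interfere, so
  crossing edges of equal orientation in such columns need pairwise different types.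
\<close>

lemma crossing_columns: "finite {c. crossing c}" "card {c. crossing c} \<le> 6 * k"
proof -
  define P where "P c r r' \<longleftrightarrow> Suc c < C \<and> r < R \<and> r' < R \<and> grid_adj d (r, c) (r', Suc c)" for c r r'
  \<comment> \<open>In \<open>A\<close> the left end of the crossing edge lies in \<open>S\<close>,
    in \<open>B\<close> the right end. Two orientations, three residues and \<open>k\<close> types
    give the bound \<open>6 * k\<close>.\<close>
  define A where "A i = {c. c mod 3 = i \<and> (\<exists>r r'. P c r r' \<and> (r, c) \<in> S \<and> (r', Suc c) \<notin> S)}" for i
  define B where "B i = {c. c mod 3 = i \<and> (\<exists>r r'. P c r r' \<and> (r, c) \<notin> S \<and> (r', Suc c) \<in> S)}" for i
  \<comment> \<open>The point chosen outside \<open>S\<close> has neighbours only in the two columns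
    beside its own. Among the columns of one residue class, only that of its own partner can be one
    of these, so it distinguishes the partner from all other members of the family.\<close>
  have mod3: "c' \<noteq> Suc (Suc c)" if "c mod 3 = c' mod 3" for c c' :: nat
    using that by presburger
  have A: "finite (A i) \<and> card (A i) \<le> k" for i
  proof -
    have "\<forall>c\<in>A i. \<exists>r r'. P c r r' \<and> (r, c) \<in> S \<and> (r', Suc c) \<notin> S"
      by (auto simp: A_def)
    then obtain a b where ab: "\<And>c. c \<in> A i \<Longrightarrow> P c (a c) (b c) \<and> (a c, c) \<in> S \<and> (b c, Suc c) \<notin> S"
      by metis
    show ?thesis
    proof (rule few_types[of "\<lambda>c. (a c, c)"])
      fix c c' assume c: "c \<in> A i" "c' \<in> A i" "c \<noteq> c'"
      then have "c mod 3 = c' mod 3" by (simp add: A_def)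
      then have "\<not> grid_adj d (a c', c') (b c, Suc c)"
        using c(3) mod3[of c c'] by (auto simp: grid_adj_def)
      then show "\<exists>z\<in>{..<R} \<times> {..<C} - S. grid_adj d (a c, c) z \<noteq> grid_adj d (a c', c') z"
        using ab[OF c(1)] by (intro bexI[of _ "(b c, Suc c)"]) (auto simp: P_def)
    qed (use ab in auto)
  qed
  have B: "finite (B i) \<and> card (B i) \<le> k" for i
  proof -
    have "\<forall>c\<in>B i. \<exists>r r'. P c r r' \<and> (r, c) \<notin> S \<and> (r', Suc c) \<in> S"
      by (auto simp: B_def)
    then obtain a b where ab: "\<And>c. c \<in> B i \<Longrightarrow> P c (a c) (b c) \<and> (a c, c) \<notin> S \<and> (b c, Suc c) \<in> S"
      by metis
    show ?thesis
    proof (rule few_types[of "\<lambda>c. (b c, Suc c)"])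
      fix c c' assume c: "c \<in> B i" "c' \<in> B i" "c \<noteq> c'"
      then have "c mod 3 = c' mod 3" by (simp add: B_def)
      then have "\<not> grid_adj d (b c', Suc c') (a c, c)"
        using c(3) mod3[of c' c] by (auto simp: grid_adj_def)
      then show "\<exists>z\<in>{..<R} \<times> {..<C} - S. grid_adj d (b c, Suc c) z \<noteq> grid_adj d (b c', Suc c') z"
        using ab[OF c(1)] grid_adj_sym[of d "(a c, c)"]
        by (intro bexI[of _ "(a c, c)"]) (auto simp: P_def)
    qed (use ab in auto)
  qed
  have sub: "{c. crossing c} \<subseteq> (\<Union>i<3. A i \<union> B i)"
  proof
    fix c assume "c \<in> {c. crossing c}"
    then have "c \<in> A (c mod 3) \<union> B (c mod 3)"
      unfolding crossing_def A_def B_def P_def by blast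
    moreover have "c mod 3 < 3" by simp
    ultimately show "c \<in> (\<Union>i<3. A i \<union> B i)" by blast
  qed
  moreover have fin: "finite (\<Union>i<3. A i \<union> B i)" using A B by auto
  ultimately show "finite {c. crossing c}" by (rule finite_subset)
  have "card {c. crossing c} \<le> card (\<Union>i<3. A i \<union> B i)"
    using fin sub by (rule card_mono)
  also have "\<dots> \<le> (\<Sum>i<3. card (A i \<union> B i))"
    by (rule card_UN_le) simp
  also have "\<dots> \<le> (\<Sum>i<3::nat. 2 * k)"
    using A B by (intro sum_mono order_trans[OF card_Un_le]) (simp add: add_mono mult_2)
  finally show "card {c. crossing c} \<le> 6 * k" by simp
qed

text \<open>For each orientation, the end of a cut row outside \<open>S\<close> distinguishes that
  row's point of \<open>S\<close> from those of the other rows: it is adjacent to that point alone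
  in a matching, and to all but that point in a complement.\<close>

lemma cut_rows_at:
  assumes "Suc c < C"
  shows "finite {r. r < R \<and> cut_row c r}" "card {r. r < R \<and> cut_row c r} \<le> 2 * k"
proof -
  define A where "A = {r. r < R \<and> (r, c) \<in> S \<and> (r, Suc c) \<notin> S}"
  define B where "B = {r. r < R \<and> (r, c) \<notin> S \<and> (r, Suc c) \<in> S}"
  have "finite A \<and> card A \<le> k"
  proof (rule few_types[of "\<lambda>r. (r, c)"])
    fix r r' assume "r \<in> A" "r' \<in> A" "r \<noteq> r'"
    then show "\<exists>z\<in>{..<R} \<times> {..<C} - S. grid_adj d (r, c) z \<noteq> grid_adj d (r', c) z"
      using assms by (intro bexI[of _ "(r, Suc c)"]) (auto simp: A_def grid_adj_Suc)
  qed (auto simp: A_def)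
  moreover have "finite B \<and> card B \<le> k"
  proof (rule few_types[of "\<lambda>r. (r, Suc c)"])
    fix r r' assume "r \<in> B" "r' \<in> B" "r \<noteq> r'"
    then show "\<exists>z\<in>{..<R} \<times> {..<C} - S. grid_adj d (r, Suc c) z \<noteq> grid_adj d (r', Suc c) z"
      using assms by (intro bexI[of _ "(r, c)"])
        (auto simp: B_def grid_adj_Suc grid_adj_sym[of d "(_, Suc c)"])
  qed (auto simp: B_def)
  moreover have "{r. r < R \<and> cut_row c r} = A \<union> B"
    by (auto simp: A_def B_def cut_row_def)
  moreover have "card (A \<union> B) \<le> card A + card B" by (rule card_Un_le)
  ultimately show "finite {r. r < R \<and> cut_row c r}" "card {r. r < R \<and> cut_row c r} \<le> 2 * k"
    by auto
qed

text \<open>If \<open>d dvd c\<close> and no edge crossed, membership in \<open>S\<close> would be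
  constant along the path \<open>(r, c)\<close>, \<open>(x, Suc c)\<close>, \<open>(y, c)\<close>,
  \<open>(r, Suc c)\<close> for distinct rows \<open>r\<close>, \<open>x\<close>, \<open>y\<close>;
  hence three rows. In a matching the row itself is an edge.\<close>

lemma cut_row_crossing:
  assumes "3 \<le> R" "r < R" "Suc c < C" "cut_row c r"
  shows "crossing c"
proof (rule ccontr)
  assume no: "\<not> crossing c"
  have eq: "(x, c) \<in> S \<longleftrightarrow> (y, Suc c) \<in> S" if "x < R" "y < R" "x = y \<longleftrightarrow> \<not> d dvd c" for x y
    using no that assms(3) unfolding crossing_def grid_adj_Suc by blast
  have "(r, c) \<in> S \<longleftrightarrow> (r, Suc c) \<in> S"
  proof (cases "d dvd c")
    case True
    have "card ({..<3} - {r}) \<ge> 2" by (simp add: card_Diff_singleton_if)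
    then obtain T where "T \<subseteq> {..<3} - {r}" "card T = 2" by (rule obtain_subset_with_card_n)
    then obtain x y where "x < 3" "y < 3" "x \<noteq> r" "y \<noteq> r" "x \<noteq> y"
      by (auto simp: card_2_iff)
    then have "(r, c) \<in> S \<longleftrightarrow> (x, Suc c) \<in> S" "(y, c) \<in> S \<longleftrightarrow> (x, Suc c) \<in> S"
        "(y, c) \<in> S \<longleftrightarrow> (r, Suc c) \<in> S"
      using eq[of r x] eq[of y x] eq[of y r] True assms(1,2) by simp_all
    then show ?thesis by blast
  next
    case False
    then show ?thesis using assms(2) by (intro eq) auto
  qed
  then show False using assms(4) by (simp add: cut_row_def)
qed

text \<open>Only the at most \<open>6 * k\<close> crossing columns can cut a row, and each cuts at
  most \<open>2 * k\<close> rows.\<close>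

lemma cut_rows:
  assumes "3 \<le> R"
  shows "finite {r. r < R \<and> (\<exists>c. Suc c < C \<and> cut_row c r)}"
    "card {r. r < R \<and> (\<exists>c. Suc c < C \<and> cut_row c r)} \<le> 12 * k * k"
proof -
  show "finite {r. r < R \<and> (\<exists>c. Suc c < C \<and> cut_row c r)}" by simp
  let ?U = "\<Union>c\<in>{c. crossing c}. {r. r < R \<and> cut_row c r}"
  have "{r. r < R \<and> (\<exists>c. Suc c < C \<and> cut_row c r)} \<subseteq> ?U"
    using cut_row_crossing[OF assms] by auto
  then have "card {r. r < R \<and> (\<exists>c. Suc c < C \<and> cut_row c r)} \<le> card ?U"
    using crossing_columns(1) by (intro card_mono) auto
  also have "\<dots> \<le> (\<Sum>c\<in>{c. crossing c}. card {r. r < R \<and> cut_row c r})"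
    using crossing_columns(1) by (rule card_UN_le)
  also have "\<dots> \<le> (\<Sum>c\<in>{c. crossing c}. 2 * k)"
    by (intro sum_mono cut_rows_at(2)) (auto simp: crossing_def)
  also have "\<dots> \<le> 6 * k * (2 * k)"
    using crossing_columns(2) by simp
  finally show "card {r. r < R \<and> (\<exists>c. Suc c < C \<and> cut_row c r)} \<le> 12 * k * k" by simp
qed

text \<open>Both sides of the cut have at least \<open>Suc (12 * k * k) * C\<close> points, more
  than all cut rows together, so some row lies entirely in \<open>S\<close> and another entirely
  outside. The complemented pairs at columns \<open>0\<close>, \<open>d\<close>, up to
  \<open>6 * k * d\<close> then all cross, one more than \<open>crossing_columns\<close> permits;
  \<open>C\<close> is just large enough to contain them.\<close>

lemma not_balanced:
  assumes d: "0 < d" and R: "R = 3 * Suc (12 * k * k)" and C: "C = 6 * k * d + 2"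
    and S: "S \<subseteq> {..<R} \<times> {..<C}"
    and lower: "Suc (12 * k * k) * C \<le> card S" and upper: "card S < 2 * (Suc (12 * k * k) * C)"
  shows False
proof -
  let ?U = "{r. r < R \<and> (\<exists>c. Suc c < C \<and> cut_row c r)}"
  have R3: "3 \<le> R" using R by simp
  note U = cut_rows[OF R3]
  have small: "card (?U \<times> {..<C}) < Suc (12 * k * k) * C"
  proof -
    have "card (?U \<times> {..<C}) \<le> 12 * k * k * C"
      using U by (simp add: card_cartesian_product)
    also have "\<dots> < Suc (12 * k * k) * C" using C by simp
    finally show ?thesis .
  qed
  \<comment> \<open>Away from the cut rows, column 0 decides for the entire row.\<close>
  have const: "(r, c) \<in> S \<longleftrightarrow> (r, 0) \<in> S" if "r < R" "r \<notin> ?U" "c < C" for r c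
    using that(3)
  proof (induction c)
    case (Suc c)
    then have "\<not> cut_row c r" using that by blast
    then show ?case using Suc by (simp add: cut_row_def)
  qed simp
  have "\<not> S \<subseteq> ?U \<times> {..<C}"
  proof
    assume "S \<subseteq> ?U \<times> {..<C}"
    then have "card S \<le> card (?U \<times> {..<C})" by (intro card_mono) auto
    then show False using small lower by linarith
  qed
  then obtain r c where "(r, c) \<in> S" "(r, c) \<notin> ?U \<times> {..<C}" by auto
  then have r: "r < R" "\<And>c. c < C \<Longrightarrow> (r, c) \<in> S"
    using S const[of r] by blast+
  \<comment> \<open>The grid has three times the lower bound many points and \<open>S\<close> fewer
    than twice as many, so the complement exceeds the lower bound too.\<close>
  have "\<not> {..<R} \<times> {..<C} - S \<subseteq> ?U \<times> {..<C}"
  proof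
    assume "{..<R} \<times> {..<C} - S \<subseteq> ?U \<times> {..<C}"
    then have "card ({..<R} \<times> {..<C} - S) \<le> card (?U \<times> {..<C})" by (intro card_mono) auto
    moreover have "card ({..<R} \<times> {..<C} - S) = R * C - card S"
      using S finite_subset[OF S] by (simp add: card_Diff_subset card_cartesian_product)
    moreover have "R * C = 3 * (Suc (12 * k * k) * C)" unfolding R by (rule mult.assoc)
    ultimately show False using small upper by linarith
  qed
  then obtain r' c' where "(r', c') \<in> {..<R} \<times> {..<C} - S" "(r', c') \<notin> ?U \<times> {..<C}" by auto
  then have r': "r' < R" "\<And>c. c < C \<Longrightarrow> (r', c) \<notin> S"
    using const[of r'] by blast+
  have "r \<noteq> r'" using r(2)[of 0] r'(2)[of 0] C by auto
  have "(\<lambda>i. d * i) ` {..6 * k} \<subseteq> {c. crossing c}"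
  proof
    fix c assume "c \<in> (\<lambda>i. d * i) ` {..6 * k}"
    then obtain i where i: "c = d * i" "i \<le> 6 * k" by auto
    then have "c \<le> d * (6 * k)" by simp
    then have "Suc c < C" using C by (simp add: mult.commute)
    moreover have "grid_adj d (r, c) (r', Suc c)"
      using i \<open>r \<noteq> r'\<close> by (simp add: grid_adj_Suc)
    moreover have "(r, c) \<in> S" "(r', Suc c) \<notin> S"
      using r(2)[of c] r'(2)[of "Suc c"] \<open>Suc c < C\<close> by auto
    ultimately show "c \<in> {c. crossing c}"
      unfolding crossing_def using r(1) r'(1) by blast
  qed
  then have "card ((\<lambda>i. d * i) ` {..6 * k}) \<le> 6 * k"
    using card_mono[OF crossing_columns(1)] crossing_columns(2) order_trans by blast
  moreover have "card ((\<lambda>i. d * i) ` {..6 * k}) = Suc (6 * k)"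
    using d by (subst card_image) (auto simp: inj_on_def)
  ultimately show False by simp
qed

end

lemma grid_class_unbounded_cwd:
  assumes d: "0 < d"
  shows "\<exists>G :: nat graph \<in> grid_class d. k < cwd G"
proof -
  define Q R C where "Q = Suc (12 * k * k)" and "R = 3 * Q" and "C = 6 * k * d + 2"
  have "{..<R} \<times> {..<C} \<noteq> {}" by (simp add: Q_def R_def C_def lessThan_empty_iff)
  then obtain G :: "nat graph" and f where G: "G \<in> grid_class d" "grid_embedding d G f"
    and fV: "f ` verts G = {..<R} \<times> {..<C}"
    using ex_grid_class_graph[of "{..<R} \<times> {..<C}" d] by blast
  have simple: "simple_graph G" using G by (simp add: grid_class_def)
  have inj: "inj_on f (verts G)"
    and E: "\<And>u v. u \<in> verts G \<Longrightarrow> v \<in> verts G \<Longrightarrow> {u, v} \<in> edges G \<longleftrightarrow> grid_adj d (f u) (f v)"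
    using G(2) by (auto simp: grid_embedding_def)
  have cardV: "card (verts G) = 3 * (Q * C)"
    using card_image[OF inj] fV by (simp add: card_cartesian_product R_def)
  have "\<not> cwd G \<le> k"
  proof
    assume "cwd G \<le> k"
    then obtain t where t: "cw_wf t" "cw_verts t = verts G" "cw_edges t = edges G"
      and tk: "card (cw_labels t) \<le> k"
      using ex_cw_constructs_cwd[OF simple] by (auto simp: cw_constructs_def)
    have "1 \<le> Q * C" by (simp add: Q_def C_def)
    then obtain S l where cut: "label_cut t S l" and S: "Q * C \<le> card S" "card S < 2 * (Q * C)"
      using ex_balanced_label_cut[OF t(1), of "Q * C"] t(2) cardV by auto
    note cutD = label_cutD[OF cut, unfolded t]
    have SV: "S \<subseteq> verts G" using cutD(1) by blast
    define g where "g = inv_into (verts G) f"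
    have g: "g (f u) = u" if "u \<in> verts G" for u
      using that inj by (simp add: g_def)
    \<comment> \<open>Points of \<open>S\<close> with equal labels under \<open>l\<close> have the
      same neighbours outside \<open>S\<close>. Pairwise distinguished points therefore get
      different labels, of which there are at most \<open>k\<close>.\<close>
    have cut': "grid_cut d R C k (f ` S)"
    proof
      fix a and T :: "nat set"
      assume a: "a ` T \<subseteq> f ` S" and sep: "\<And>i j. i \<in> T \<Longrightarrow> j \<in> T \<Longrightarrow> i \<noteq> j \<Longrightarrow>
        \<exists>z\<in>{..<R} \<times> {..<C} - f ` S. grid_adj d (a i) z \<noteq> grid_adj d (a j) z"
      have ga: "g (a i) \<in> S" "f (g (a i)) = a i" if i: "i \<in> T" for i
      proof -
        obtain u where "u \<in> S" "a i = f u" using a i by blast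
        then show "g (a i) \<in> S" "f (g (a i)) = a i" using g SV by auto
      qed
      have "inj_on (\<lambda>i. l (g (a i))) T"
      proof (rule inj_onI, rule ccontr)
        fix i j assume ij: "i \<in> T" "j \<in> T" "l (g (a i)) = l (g (a j))" "i \<noteq> j"
        then obtain z where z: "z \<in> f ` verts G" "z \<notin> f ` S" "grid_adj d (a i) z \<noteq> grid_adj d (a j) z"
          using sep[of i j] fV by blast
        then obtain w where w: "w \<in> verts G" "w \<notin> S" "z = f w" by blast
        have "{g (a i), w} \<in> edges G \<longleftrightarrow> {g (a j), w} \<in> edges G"
          using cutD(4)[of "g (a i)" "g (a j)" w] ga ij w by blast
        then show False
          using E[of "g (a i)" w] E[of "g (a j)" w] ga[OF ij(1)] ga[OF ij(2)] w z(3) SV by auto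
      qed
      moreover have "(\<lambda>i. l (g (a i))) ` T \<subseteq> cw_labels t"
        using cutD(2) ga(1) by blast
      ultimately show "finite T \<and> card T \<le> k"
        using finite_cw_labels[of t] tk inj_on_finite card_inj_on_le order_trans by metis
    qed
    have "f ` S \<subseteq> {..<R} \<times> {..<C}" using fV SV by blast
    moreover have "card (f ` S) = card S"
      using inj_on_subset[OF inj SV] by (rule card_image)
    ultimately show False
      using grid_cut.not_balanced[OF cut' d, unfolded R_def Q_def C_def] S
      unfolding R_def Q_def C_def by metis
  qed
  then show ?thesis using G(1) by (intro bexI[of _ G]) auto
qed

section \<open>Grid graphs without full blocks have small linear clique-width\<close>

text \<open>
  Columns are grouped into windows of \<open>n\<close> consecutive ones. Within its window, a row is split
  at its first missing point: what lies behind the gap is postponed to the next stage, so that a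
  horizontal edge leads from one stage to another only in a row that fills its whole window.
\<close>

definition stage :: "nat \<Rightarrow> (nat \<times> nat) set \<Rightarrow> nat \<Rightarrow> nat \<Rightarrow> nat" where
  "stage n F r c =
    (if \<forall>c'\<in>{c div n * n..c}. (r, c') \<in> F then c div n else Suc (c div n))"

definition full_rows :: "nat \<Rightarrow> (nat \<times> nat) set \<Rightarrow> nat \<Rightarrow> nat set" where
  "full_rows n F t = {r. \<forall>c\<in>{t * n..<Suc t * n}. (r, c) \<in> F}"

lemma stage_bounds: "c div n \<le> stage n F r c" "stage n F r c \<le> Suc (c div n)"
  by (auto simp: stage_def)

text \<open>A gap delays the rest of its window by one stage only, so no point is put behind the
  next window of its row.\<close>

lemma stage_mono:
  assumes "c \<le> c'"
  shows "stage n F r c \<le> stage n F r c'"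
proof (cases "c div n = c' div n")
  case True
  then show ?thesis using assms by (auto simp: stage_def)
next
  case False
  then have "Suc (c div n) \<le> c' div n"
    using div_le_mono[OF assms, of n] by simp
  then show ?thesis
    using stage_bounds(2)[of n F r c] stage_bounds(1)[of c' n F r] by linarith
qed

text \<open>Inside a window the stage changes only at a missing point. If the window has a gap in
  this row, its last part already has the stage of the next window, so a jump at the boundary means
  that the row fills the window.\<close>

lemma stage_jump:
  assumes n: "0 < n" and F: "(r, Suc c) \<in> F" and jump: "stage n F r c \<noteq> stage n F r (Suc c)"
  shows "r \<in> full_rows n F (stage n F r c)" "Suc c = Suc (stage n F r c) * n"
    "stage n F r (Suc c) = Suc (stage n F r c)"
proof -
  have mod: "Suc c mod n = 0"
  proof (rule ccontr)
    assume "Suc c mod n \<noteq> 0"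
    then have eq: "Suc c div n = c div n"
      by (simp add: div_Suc)
    then have "{Suc c div n * n..Suc c} = insert (Suc c) {c div n * n..c}"
      by (simp add: atLeastAtMostSuc_conv div_times_less_eq_dividend le_SucI)
    then have "stage n F r c = stage n F r (Suc c)"
      using F eq by (simp add: stage_def)
    then show False using jump by simp
  qed
  then have div: "Suc c div n = Suc (c div n)" by (simp add: div_Suc)
  then have c: "Suc c = Suc (c div n) * n"
    using div_mult_mod_eq[of "Suc c" n] mod by simp
  have "{Suc c div n * n..Suc c} = {Suc c}" using c div by simp
  then have Suc_stage: "stage n F r (Suc c) = Suc (c div n)"
    using F div by (simp add: stage_def)
  then have st: "stage n F r c = c div n"
    using jump unfolding stage_def by (auto split: if_splits)
  then have "\<forall>c'\<in>{c div n * n..c}. (r, c') \<in> F"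
    by (auto simp: stage_def split: if_splits)
  moreover have "{c div n * n..c} = {c div n * n..<Suc (c div n) * n}"
    unfolding c[symmetric] by auto
  ultimately show "r \<in> full_rows n F (stage n F r c)"
    unfolding full_rows_def st by auto
  show "Suc c = Suc (stage n F r c) * n" "stage n F r (Suc c) = Suc (stage n F r c)"
    using c st Suc_stage by simp_all
qed

lemma finite_full_rows:
  assumes "0 < n" "finite F"
  shows "finite (full_rows n F t)"
proof (rule finite_subset)
  show "full_rows n F t \<subseteq> fst ` F"
    using assms(1) by (force simp: full_rows_def)
qed (use assms in simp)

text \<open>Vertices are ordered by stage, then row, then column. At a cut of this order, at most
  \<open>2 * B + 1\<close> vertices can have an edge to a later vertex of their own row. For all
  others the later neighbourhood depends only on the column; it is empty unless the column is one of
  at most \<open>K\<close> ends of complemented pairs near the cut. With the empty type this makes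
  \<open>2 * B + K + 2\<close>.\<close>

lemma lcwd_le_full_rows:
  fixes G :: "'a graph"
  assumes G: "simple_graph G" and f: "grid_embedding d G f" and n: "0 < n"
    and full: "\<And>t. card (full_rows n (f ` verts G) t) \<le> B"
    and cols: "\<And>a. card {c \<in> {a..<a + 3 * n}. d dvd c \<or> (\<exists>y. c = Suc y \<and> d dvd y)} \<le> K"
  shows "lcwd G \<le> 2 * Suc (2 * B + K + 2)"
proof (rule lcwd_le_linear_layout)
  let ?V = "verts G" and ?F = "f ` verts G"
  let ?s = "stage n ?F"
  let ?key = "\<lambda>v. (?s (fst (f v)) (snd (f v)), fst (f v), snd (f v))"
  have fin: "finite ?V" using G by (simp add: simple_graph_def)
  have inj: "inj_on f ?V"
    and E: "\<And>u v. u \<in> ?V \<Longrightarrow> v \<in> ?V \<Longrightarrow> {u, v} \<in> edges G \<longleftrightarrow> grid_adj d (f u) (f v)"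
    using f by (auto simp: grid_embedding_def)
  show "simple_graph G" by (fact G)
  show "inj_on ?key ?V"
    using inj by (auto simp: inj_on_def prod_eq_iff)
  fix v assume v: "v \<in> ?V"
  obtain \<rho> \<gamma> where fv: "f v = (\<rho>, \<gamma>)" by fastforce
  define \<sigma> where "\<sigma> = ?s \<rho> \<gamma>"
  let ?P = "{u \<in> ?V. ?key u \<le> ?key v}"
  let ?N = "\<lambda>u. {z \<in> ?V. ?key v < ?key z \<and> {u, z} \<in> edges G}"
  \<comment> \<open>The exceptional points are the last vertex \<open>v\<close> of the prefix and,
    in the two stages concerned, the points of full rows in the last column
    \<open>Suc t * n - 1\<close> of window \<open>t\<close>.\<close>
  define Sp where "Sp = insert (\<rho>, \<gamma>)
    (\<Union>t\<in>{\<sigma> - 1, \<sigma>}. (\<lambda>r. (r, Suc t * n - 1)) ` full_rows n ?F t)"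
  define M where "M c = {z \<in> ?V. ?key v < ?key z \<and>
    (snd (f z) = Suc c \<and> d dvd c \<or> c = Suc (snd (f z)) \<and> d dvd snd (f z))}" for c
  \<comment> \<open>A later neighbour has stage at least \<open>\<sigma>\<close>, hence window at
    least \<open>\<sigma> - 1\<close>, and lies at most one window beyond column \<open>c\<close>;
    so \<open>c\<close> lies in one of the windows from \<open>\<sigma> - 2\<close> to
    \<open>\<sigma>\<close>.\<close>
  define Cols where "Cols = {c \<in> {(\<sigma> - 2) * n..<(\<sigma> - 2) * n + 3 * n}. d dvd c \<or> (\<exists>y. c = Suc y \<and> d dvd y)}"
  have key_le: "?s r c < \<sigma> \<or> ?s r c = \<sigma> \<and> (r < \<rho> \<or> r = \<rho> \<and> c \<le> \<gamma>)"
    if "u \<in> ?P" "f u = (r, c)" for u r c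
    using that fv by (auto simp: \<sigma>_def)
  have key_gr: "\<sigma> < ?s r c \<or> ?s r c = \<sigma> \<and> (\<rho> < r \<or> r = \<rho> \<and> \<gamma> < c)"
    if "?key v < ?key z" "f z = (r, c)" for z r c
    using that fv by (auto simp: \<sigma>_def)
  \<comment> \<open>Within one stage, consecutive points of a row on different sides of the cut
    force \<open>u\<close> to be \<open>v\<close> itself; otherwise \<open>stage_jump\<close> puts
    \<open>u\<close> at the end of a full row.\<close>
  have right: "f u \<in> Sp"
    if u: "u \<in> ?P" "f u = (r, c)" and z: "z \<in> ?V" "?key v < ?key z" "f z = (r, Suc c)" for u z r c
  proof (cases "?s r c = ?s r (Suc c)")
    case True
    then have "r = \<rho>" "c = \<gamma>" using key_le[OF u] key_gr[OF z(2,3)] by auto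
    then show ?thesis using u by (simp add: Sp_def)
  next
    case False
    have "(r, Suc c) \<in> ?F" using z by force
    note j = stage_jump[OF n this False]
    have "?s r c \<in> {\<sigma> - 1, \<sigma>}" using j(3) key_le[OF u] key_gr[OF z(2,3)] by auto
    moreover have "f u = (r, Suc (?s r c) * n - 1)" using u(2) j(2) by simp
    ultimately show ?thesis using j(1) unfolding Sp_def by blast
  qed
  \<comment> \<open>Stages do not decrease along a row, so a left neighbour in the row never comes
    later.\<close>
  have left: False
    if u: "u \<in> ?P" "f u = (r, Suc c)" and z: "?key v < ?key z" "f z = (r, c)" for u z r c
    using key_le[OF u] key_gr[OF z] stage_mono[of c "Suc c" n ?F r] by auto
  have N_M: "?N u = M c" if u: "u \<in> ?P" "f u \<notin> Sp" "f u = (r, c)" for u r c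
  proof -
    have "{u, z} \<in> edges G \<longleftrightarrow>
        snd (f z) = Suc c \<and> d dvd c \<or> c = Suc (snd (f z)) \<and> d dvd snd (f z)"
      if z: "z \<in> ?V" "?key v < ?key z" for z
    proof -
      obtain x y where fz: "f z = (x, y)" by fastforce
      have "x \<noteq> r" if "y = Suc c"
        using right[OF u(1,3) z] fz that u(2) by auto
      moreover have "x \<noteq> r" if "c = Suc y"
        using left[of u r y z] u fz z that by auto
      moreover have "{u, z} \<in> edges G \<longleftrightarrow> grid_adj d (r, c) (x, y)"
        using E[of u z] u z fz by simp
      ultimately show ?thesis unfolding grid_adj_def fz by auto
    qed
    then show ?thesis unfolding M_def by blast
  qed
  have M_Cols: "c \<in> Cols" if u: "u \<in> ?P" "f u = (r, c)" and ne: "M c \<noteq> {}" for u r c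
  proof -
    from ne obtain z where z: "?key v < ?key z"
      and adj: "snd (f z) = Suc c \<and> d dvd c \<or> c = Suc (snd (f z)) \<and> d dvd snd (f z)"
      by (auto simp: M_def)
    obtain x y where fz: "f z = (x, y)" by fastforce
    have "c div n \<le> ?s r c" by (rule stage_bounds)
    then have up: "c div n \<le> \<sigma>" using key_le[OF u] by auto
    have "y \<le> c + n" using adj fz n by auto
    then have "y div n \<le> (c + n) div n" by (rule div_le_mono)
    then have "y div n \<le> Suc (c div n)" using n div_add_self2[of n c] by linarith
    moreover have "?s x y \<le> Suc (y div n)" by (rule stage_bounds)
    ultimately have low: "\<sigma> - 2 \<le> c div n" using key_gr[OF z fz] by auto
    have "(\<sigma> - 2) * n \<le> c div n * n" using low by (rule mult_le_mono1)
    then have "(\<sigma> - 2) * n \<le> c" using div_times_less_eq_dividend order_trans by blast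
    moreover have "c < (\<sigma> - 2) * n + 3 * n"
    proof -
      have "c < Suc (c div n) * n" using n by (metis dividend_less_div_times mult_Suc)
      also have "\<dots> \<le> (\<sigma> - 2 + 3) * n" using up by (intro mult_le_mono1) linarith
      finally show ?thesis by (simp add: add_mult_distrib)
    qed
    moreover have "d dvd c \<or> (\<exists>y. c = Suc y \<and> d dvd y)" using adj by blast
    ultimately show ?thesis by (simp add: Cols_def)
  qed
  have finF: "finite ?F" using fin by simp
  have finSp: "finite Sp" unfolding Sp_def using finite_full_rows[OF n finF] by auto
  have cardSp: "card Sp \<le> Suc (2 * B)"
  proof -
    have "card ((\<lambda>r. (r, Suc t * n - 1)) ` full_rows n ?F t) \<le> B" for t
      using card_image_le[OF finite_full_rows[OF n finF]] full order_trans by blast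
    then have "card (\<Union>t\<in>{\<sigma> - 1, \<sigma>}. (\<lambda>r. (r, Suc t * n - 1)) ` full_rows n ?F t)
        \<le> (\<Sum>t\<in>{\<sigma> - 1, \<sigma>}. B)"
      by (intro order_trans[OF card_UN_le] sum_mono) auto
    also have "\<dots> \<le> 2 * B"
      by (cases "\<sigma> = 0") auto
    finally show ?thesis
      unfolding Sp_def by (intro order_trans[OF card_insert_le_m1]) auto
  qed
  have "?N ` ?P \<subseteq> ?N ` {u \<in> ?V. f u \<in> Sp} \<union> insert {} (M ` Cols)"
  proof
    fix X assume "X \<in> ?N ` ?P"
    then obtain u where u: "u \<in> ?P" "X = ?N u" by blast
    obtain r c where fu: "f u = (r, c)" by fastforce
    show "X \<in> ?N ` {u \<in> ?V. f u \<in> Sp} \<union> insert {} (M ` Cols)"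
    proof (cases "f u \<in> Sp")
      case True
      then show ?thesis using u by blast
    next
      case False
      then have "X = M c" using N_M[OF u(1) _ fu] u(2) by simp
      then show ?thesis using M_Cols[OF u(1) fu] by blast
    qed
  qed
  moreover have finC: "finite Cols" by (simp add: Cols_def)
  ultimately have "card (?N ` ?P) \<le> card (?N ` {u \<in> ?V. f u \<in> Sp} \<union> insert {} (M ` Cols))"
    using fin by (intro card_mono) auto
  also have "\<dots> \<le> card (?N ` {u \<in> ?V. f u \<in> Sp}) + card (insert {} (M ` Cols))"
    by (rule card_Un_le)
  also have "\<dots> \<le> Suc (2 * B) + Suc K"
  proof (rule add_mono)
    have "card (?N ` {u \<in> ?V. f u \<in> Sp}) \<le> card {u \<in> ?V. f u \<in> Sp}"
      using fin by (intro card_image_le) simp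
    also have "\<dots> \<le> card Sp"
      using finSp inj_on_subset[OF inj] by (intro card_inj_on_le[of f]) auto
    finally show "card (?N ` {u \<in> ?V. f u \<in> Sp}) \<le> Suc (2 * B)"
      using cardSp by simp
    have "card (M ` Cols) \<le> card Cols" using finC by (rule card_image_le)
    also have "\<dots> \<le> K" unfolding Cols_def by (rule cols)
    finally show "card (insert {} (M ` Cols)) \<le> Suc K"
      using card_insert_le_m1[of "Suc K" "M ` Cols" "{}"] by simp
  qed
  finally show "card (?N ` ?P) \<le> 2 * B + K + 2" by simp
qed

text \<open>Windows longer than the number of vertices contain no full row, so \<open>B\<close> is
  0. Three of them span fewer than \<open>d\<close> columns, hence at most one multiple of
  \<open>d\<close> and one successor of a multiple, so \<open>K\<close> is 2 and the bound becomes
  10.\<close>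

lemma lcwd_le_sparse:
  fixes G :: "'a graph"
  assumes "G \<in> grid_class d" "3 * Suc (card (verts G)) < d"
  shows "lcwd G \<le> 10"
proof -
  from assms(1) obtain f where G: "simple_graph G" and f: "grid_embedding d G f"
    by (auto simp: grid_class_def)
  let ?n = "Suc (card (verts G))" and ?F = "f ` verts G"
  have fin: "finite (verts G)" using G by (simp add: simple_graph_def)
  have "full_rows ?n ?F t = {}" for t
  proof (rule ccontr)
    assume "full_rows ?n ?F t \<noteq> {}"
    then obtain r where "\<forall>c\<in>{t * ?n..<Suc t * ?n}. (r, c) \<in> ?F" by (auto simp: full_rows_def)
    then have "Pair r ` {t * ?n..<Suc t * ?n} \<subseteq> ?F" by blast
    then have "card (Pair r ` {t * ?n..<Suc t * ?n}) \<le> card ?F"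
      using fin by (intro card_mono) auto
    moreover have "card (Pair r ` {t * ?n..<Suc t * ?n}) = ?n"
      by (subst card_image) (auto simp: inj_on_def)
    ultimately show False using card_image_le[OF fin, of f] by simp
  qed
  then have full: "card (full_rows ?n ?F t) \<le> 0" for t by simp
  have cols: "card {c \<in> {a..<a + 3 * ?n}. d dvd c \<or> (\<exists>y. c = Suc y \<and> d dvd y)} \<le> 2" for a
  proof -
    have uniq: "x = y" if "x \<in> {a..<a + d}" "y \<in> {a..<a + d}" "d dvd x" "d dvd y" for a x y :: nat
    proof (rule ccontr)
      assume "x \<noteq> y"
      have "d dvd x - y" "d dvd y - x" using that by (auto intro: dvd_diff_nat)
      then have "x - y = 0 \<or> d \<le> x - y" "y - x = 0 \<or> d \<le> y - x"
        using dvd_imp_le by blast+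
      then show False using that \<open>x \<noteq> y\<close> by auto
    qed
    let ?A = "{c \<in> {a..<a + 3 * ?n}. d dvd c}" and ?B = "{c \<in> {a..<a + 3 * ?n}. \<exists>y. c = Suc y \<and> d dvd y}"
    have "card ?A \<le> Suc 0"
      using assms(2) by (subst card_le_Suc0_iff_eq) (auto intro!: uniq[of _ a])
    moreover have "card ?B \<le> Suc 0"
      using assms(2) by (subst card_le_Suc0_iff_eq) (auto intro!: uniq[of _ "a - 1"])
    moreover have "{c \<in> {a..<a + 3 * ?n}. d dvd c \<or> (\<exists>y. c = Suc y \<and> d dvd y)} = ?A \<union> ?B" by blast
    ultimately show ?thesis using card_Un_le[of ?A ?B] by simp
  qed
  show ?thesis
    using lcwd_le_full_rows[OF G f _ full cols] by simp
qed

section \<open>Minimality\<close>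

text \<open>Adjacency depends on rows only through equality and on columns only through succession
  and divisibility by \<open>d\<close>.\<close>

lemma grid_adj_shift:
  assumes "inj_on \<rho> A" "d dvd s" "r \<in> A" "r' \<in> A"
  shows "grid_adj d (\<rho> r, c + s) (\<rho> r', c' + s) \<longleftrightarrow> grid_adj d (r, c) (r', c')"
  using assms by (auto simp: grid_adj_def inj_on_eq_iff dvd_add_left_iff)

text \<open>A window of \<open>a + d\<close> columns contains \<open>a\<close> columns starting at a multiple of \<open>d\<close>.\<close>

lemma graph_iso_in_full_rows:
  fixes G :: "'a graph" and H :: "'b graph"
  assumes d: "0 < d" and G: "simple_graph G" "grid_embedding d G g" "g ` verts G \<subseteq> {..<b} \<times> {..<a}"
    and H: "simple_graph H" "grid_embedding d H f"
    and b: "b \<le> card (full_rows (a + d) (f ` verts H) t)"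
  shows "\<exists>S. S \<subseteq> verts H \<and> S \<noteq> {} \<and> graph_iso (induced_subgraph H S) G"
proof -
  let ?n = "a + d" and ?F = "f ` verts H"
  have "finite ?F" using H(1) by (simp add: simple_graph_def)
  then have "finite (full_rows ?n ?F t)" using finite_full_rows[of ?n ?F t] d by simp
  then obtain \<rho> where \<rho>: "inj_on \<rho> {..<b}" "\<rho> ` {..<b} \<subseteq> full_rows ?n ?F t"
    using b by (metis card_le_inj card_lessThan finite_lessThan)
  \<comment> \<open>This rounds the first column of window \<open>t\<close> up to a multiple of
    \<open>d\<close>, losing fewer than \<open>d\<close> columns.\<close>
  define s where "s = d * ((t * ?n + d - 1) div d)"
  have ds: "d dvd s" by (simp add: s_def)
  have s: "t * ?n \<le> s" "s < t * ?n + d"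
  proof -
    have *: "s + (t * ?n + d - 1) mod d = t * ?n + d - 1"
      unfolding s_def by (rule mult_div_mod_eq)
    have "(t * ?n + d - 1) mod d < d" using d by simp
    then show "t * ?n \<le> s" "s < t * ?n + d" using * d by linarith+
  qed
  \<comment> \<open>The copy of \<open>G\<close> is moved by \<open>s\<close> columns and its rows
    are sent to full rows, so all its points belong to the image of \<open>H\<close>.\<close>
  define h where "h u = (\<rho> (fst (g u)), snd (g u) + s)" for u
  have gV: "fst (g u) < b" "snd (g u) < a" if "u \<in> verts G" for u
    using G(3) that by auto
  have hF: "h u \<in> ?F" if "u \<in> verts G" for u
  proof -
    have "\<rho> (fst (g u)) \<in> full_rows ?n ?F t" using \<rho>(2) gV(1)[OF that] by blast
    moreover have "snd (g u) + s \<in> {t * ?n..<Suc t * ?n}"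
      using s gV(2)[OF that] by auto
    ultimately show ?thesis by (auto simp: full_rows_def h_def)
  qed
  have g: "inj_on g (verts G)"
    "\<And>u v. u \<in> verts G \<Longrightarrow> v \<in> verts G \<Longrightarrow> {u, v} \<in> edges G \<longleftrightarrow> grid_adj d (g u) (g v)"
    using G(2) by (auto simp: grid_embedding_def)
  have f: "inj_on f (verts H)"
    "\<And>u v. u \<in> verts H \<Longrightarrow> v \<in> verts H \<Longrightarrow> {u, v} \<in> edges H \<longleftrightarrow> grid_adj d (f u) (f v)"
    using H(2) by (auto simp: grid_embedding_def)
  have inj_h: "inj_on h (verts G)"
  proof (rule inj_onI)
    fix u v assume uv: "u \<in> verts G" "v \<in> verts G" "h u = h v"
    then have "fst (g u) = fst (g v)" "snd (g u) = snd (g v)"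
      using \<rho>(1) gV(1) by (auto simp: h_def dest: inj_onD)
    then show "u = v" using g(1) uv by (auto dest: inj_onD intro: prod_eqI)
  qed
  have adj: "grid_adj d (h u) (h v) \<longleftrightarrow> {u, v} \<in> edges G" if "u \<in> verts G" "v \<in> verts G" for u v
    using grid_adj_shift[OF \<rho>(1) ds, of "fst (g u)" "fst (g v)" "snd (g u)" "snd (g v)"] gV that g(2)[OF that]
    by (simp add: h_def)
  define e where "e u = inv_into (verts H) f (h u)" for u
  have e: "e u \<in> verts H" "f (e u) = h u" if "u \<in> verts G" for u
    using hF[OF that] by (auto simp: e_def inv_into_into f_inv_into_f)
  define S where "S = e ` verts G"
  have S: "S \<subseteq> verts H" "S \<noteq> {}"
    using e G(1) by (auto simp: S_def simple_graph_def)
  have inj_e: "inj_on e (verts G)"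
    using inj_h e(2) by (metis inj_onD inj_onI)
  define i where "i = inv_into (verts G) e"
  have i: "i x \<in> verts G" "e (i x) = x" if "x \<in> S" for x
    using that by (auto simp: i_def S_def inv_into_into f_inv_into_f)
  have "bij_betw i S (verts G)"
    unfolding i_def S_def using inj_e by (intro bij_betw_inv_into inj_on_imp_bij_betw)
  moreover have "{x, y} \<in> edges (induced_subgraph H S) \<longleftrightarrow> {i x, i y} \<in> edges G" if "x \<in> S" "y \<in> S" for x y
  proof -
    have "{x, y} \<in> edges (induced_subgraph H S) \<longleftrightarrow> {x, y} \<in> edges H"
      using that by (simp add: induced_subgraph_def)
    also have "\<dots> \<longleftrightarrow> grid_adj d (h (i x)) (h (i y))"
      using f(2)[of x y] S(1) that i e(2) by (metis subsetD)
    also have "\<dots> \<longleftrightarrow> {i x, i y} \<in> edges G" using adj i that by simp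
    finally show ?thesis .
  qed
  ultimately have "graph_iso (induced_subgraph H S) G"
    unfolding graph_iso_def by (intro exI[of _ i]) (simp add: induced_subgraph_def)
  then show ?thesis using S by blast
qed

text \<open>A missing graph \<open>G\<close> fits into a box of \<open>?b\<close> rows and
  \<open>?a\<close> columns. More than \<open>?b\<close> full rows in a window of
  \<open>?a + d\<close> columns would contain a copy of \<open>G\<close>, which heredity would put
  into \<open>Y\<close>. The columns of complemented pairs in three windows are bounded by all
  \<open>3 * ?n\<close> columns.\<close>

lemma proper_subclass_bounded_lcwd:
  assumes d: "0 < d" and Y: "hereditary Y" "Y \<subset> grid_class d"
  shows "width_bounded lcwd Y"
proof -
  obtain G where "G \<in> grid_class d" and GY: "G \<notin> Y" using Y(2) by blast
  then obtain g where G: "simple_graph G" "grid_embedding d G g" by (auto simp: grid_class_def)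
  let ?b = "Suc (Max (fst ` g ` verts G))" and ?a = "Suc (Max (snd ` g ` verts G))"
  let ?n = "?a + d"
  have "finite (verts G)" using G(1) by (simp add: simple_graph_def)
  then have gV: "g ` verts G \<subseteq> {..<?b} \<times> {..<?a}"
    by (intro image_subsetI) (simp add: mem_Times_iff less_Suc_eq_le)
  have "lcwd H \<le> 2 * Suc (2 * ?b + 3 * ?n + 2)" if HY: "H \<in> Y" for H
  proof -
    obtain f where H: "simple_graph H" "grid_embedding d H f"
      using Y(2) HY by (auto simp: grid_class_def)
    have "card (full_rows ?n (f ` verts H) t) \<le> ?b" for t
    proof (rule ccontr)
      assume "\<not> ?thesis"
      then have "?b \<le> card (full_rows ?n (f ` verts H) t)" by simp
      from graph_iso_in_full_rows[OF d G gV H this]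
      obtain S where "S \<subseteq> verts H" "S \<noteq> {}" "graph_iso (induced_subgraph H S) G" by blast
      then have "G \<in> Y"
        using Y(1) HY G(1) unfolding hereditary_def graph_class_def by blast
      then show False using GY by simp
    qed
    moreover have "card {c \<in> {x..<x + 3 * ?n}. d dvd c \<or> (\<exists>y. c = Suc y \<and> d dvd y)} \<le> 3 * ?n" for x
      by (rule order_trans[OF card_mono[of "{x..<x + 3 * ?n}"]]) auto
    ultimately show ?thesis
      using H d by (intro lcwd_le_full_rows[of H d f ?n]) auto
  qed
  then show ?thesis unfolding width_bounded_def by blast
qed

text \<open>As \<open>cwd\<close> is at most \<open>lcwd\<close>, unbounded clique-width of the
  class and bounded linear clique-width of its proper subclasses settle both notions at
  once.\<close>

lemma grid_class_minimal:
  assumes d: "0 < d"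
  shows "minimal_hereditary_unbounded cwd (grid_class d :: nat graph set)"
    "minimal_hereditary_unbounded lcwd (grid_class d :: nat graph set)"
proof -
  have simple: "simple_graph G" if "hereditary Y" "G \<in> Y" for G :: "nat graph" and Y
    using that by (auto simp: hereditary_def graph_class_def)
  have cwd: "\<not> width_bounded cwd (grid_class d :: nat graph set)"
    using grid_class_unbounded_cwd[OF d] unfolding width_bounded_def by (meson not_le)
  have mono: "width_bounded cwd Y" if "hereditary Y" "width_bounded lcwd Y" for Y :: "nat graph set"
    using that simple cwd_le_lcwd order_trans unfolding width_bounded_def by metis
  have lcwd: "\<not> width_bounded lcwd (grid_class d :: nat graph set)"
    using cwd mono hereditary_grid_class by blast
  show "minimal_hereditary_unbounded cwd (grid_class d :: nat graph set)"
    "minimal_hereditary_unbounded lcwd (grid_class d :: nat graph set)"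
    unfolding minimal_hereditary_unbounded_def
    using hereditary_grid_class cwd lcwd mono proper_subclass_bounded_lcwd[OF d] by blast+
qed

section \<open>Infinitely many distinct classes\<close>

lemma grid_class_eventually_distinct:
  assumes "0 < d"
  shows "\<exists>N. \<forall>e>N. (grid_class e :: nat graph set) \<noteq> grid_class d"
proof -
  \<comment> \<open>The threshold 10 is the bound of \<open>lcwd_le_sparse\<close>: this fixed graph
    cannot belong to \<open>grid_class e\<close> once \<open>e\<close> is large compared to its
    number of vertices.\<close>
  obtain G :: "nat graph" where G: "G \<in> grid_class d" "10 < cwd G"
    using grid_class_unbounded_cwd[OF assms] by blast
  then have "10 < lcwd G"
    using cwd_le_lcwd[of G] by (auto simp: grid_class_def)
  then have "G \<notin> grid_class e" if "3 * Suc (card (verts G)) < e" for e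
    using lcwd_le_sparse[OF _ that] by (meson not_le)
  then show ?thesis using G(1) by blast
qed

theorem theorem2:
  "infinite {X :: nat graph set.
     minimal_hereditary_unbounded cwd X \<and> minimal_hereditary_unbounded lcwd X}"
proof
  assume "finite {X :: nat graph set.
     minimal_hereditary_unbounded cwd X \<and> minimal_hereditary_unbounded lcwd X}"
  then have "finite ((grid_class :: nat \<Rightarrow> nat graph set) ` {0<..})"
    by (rule rev_finite_subset) (auto intro: grid_class_minimal)
  \<comment> \<open>By the pigeonhole principle one class would equal \<open>grid_class e\<close>
    for infinitely many \<open>e\<close>, although only finitely many can give the same
    class.\<close>
  then obtain d where d: "0 < d"
    and inf: "infinite {e \<in> {0<..}. (grid_class e :: nat graph set) = grid_class d}"
    using pigeonhole_infinite[of "{0<..}" "grid_class :: nat \<Rightarrow> nat graph set"] infinite_Ioi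
    by auto
  obtain N where "\<forall>e>N. (grid_class e :: nat graph set) \<noteq> grid_class d"
    using grid_class_eventually_distinct[OF d] by blast
  then have "{e \<in> {0<..}. (grid_class e :: nat graph set) = grid_class d} \<subseteq> {..N}"
    by (auto simp: not_less[symmetric])
  then show False using inf finite_subset by blast
qed

end
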